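(* Consider an $M$-step Adams--Bashforth scheme with $M\ge2$ and order $p=M$. Assume that all roots of its discovery polynomial lie in the open unit disc, i.e. $$\rho_{\rm AB}:=\max\{|\lambda|:\lambda\in\mathbb{C},\ p_{\rm AB}(\lambda)=0\}<1,\qquad p_{\rm AB}(z)=\beta_1z^{M-1}+\beta_2z^{M-2}+\cdots+\beta_M .$$ Let $\hat R>0$ be independent of $h$, and let $u_h\in\mathcal{A}_{\hat R}$ be a zero-residual solution of the non-auxiliary loss, i.e. $J_h(u_h)=0$. Then $$\int_0^T|u_h(\mathbf{x}(t))-f(\mathbf{x}(t))|\,dt\le C_M\big(hE_0+h^p+h^p\hat R\big),$$ where $E_0=\sum_{j=0}^{M-2}|u_h(\mathbf{x}_j)-f(\mathbf{x}_j)|$ and $C_M$ is a constant independent of $h$ and $\hat R$.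
   Context: Data. $\mathbf{x}:[0,T]\to\mathbb{R}^d$ is a sufficiently smooth solution of $\dot{\mathbf{x}}=\mathbf{f}(\mathbf{x})$, $\mathbf{x}(0)=\mathbf{x}_{\rm init}$ (smooth enough for the order-$p$ truncation estimate; $\mathbf{x}\in C^{p+1}([0,T])^d$). For $N\in\mathbb{N}$, $N\ge M$, put $h=T/N$, $t_n=nh$, $\mathbf{x}_n=\mathbf{x}(t_n)$, $0\le n\le N$. $f$ denotes one fixed scalar component of $\mathbf{f}$ and $x_n$ the corresponding scalar component of $\mathbf{x}_n$. $\Omega_{\mathcal{T}}\subset\mathbb{R}^d$ is a fixed neighborhood of the trajectory $\mathcal{T}=\{\mathbf{x}(t):0\le t\le T\}$, and the admissible class $\mathcal{A}$ is a subset of $C(\Omega_{\mathcal{T}})$. Scheme. The $M$-step Adams--Bashforth (A-B) scheme is $x_n-x_{n-1}=h\sum_{m=1}^M\beta_mf_{n-m}$ (so $\alpha_0=1,\alpha_1=-1$, other $\alpha_m=0$, $\beta_0=0$) with $\beta_m=\frac{(-1)^{m-1}}{(m-1)!(M-m)!}\int_0^1\prod_{i=0,i\ne m-1}^{M-1}(u+i)\,du$, $1\le m\le M$. Non-auxiliary loss. For $u\in\mathcal{A}$, $$J_h(u)=\frac1{N-M+1}\sum_{n=M}^N\Big|\sum_{m=1}^M\beta_mu(\mathbf{x}_{n-m})-h^{-1}\sum_{m=0}^M\alpha_mx_{n-m}\Big|^2 .$$ Trace regularity class. For $\hat R>0$, $\mathcal{A}_{\hat R}$ is the set of $u\in\mathcal{A}$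 such that $g(t)=u(\mathbf{x}(t))-f(\mathbf{x}(t))$ belongs to the Sobolev space $W^{p,1}(0,T)$ with seminorm $|g|_{W^{p,1}(0,T)}=\|g^{(p)}\|_{L^1(0,T)}\le\hat R$. *)

theory Defs
  imports "HOL-Analysis.Analysis" "HOL-Computational_Algebra.Polynomial"
begin

text \<open>For \<open>S = {a..b}\<close> with \<open>a < b\<close> this is \<open>C\<^sup>k([a,b])\<close>, with one-sided derivatives
  at the end points; \<open>D j\<close> is the \<open>j\<close>-th derivative.\<close>

definition C_k_on :: "nat \<Rightarrow> real set \<Rightarrow> (real \<Rightarrow> 'a::real_normed_vector) \<Rightarrow> bool" where
  "C_k_on k S g \<longleftrightarrow>
     (\<exists>D. (\<forall>t\<in>S. D 0 t = g t) \<and>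
          (\<forall>j<k. \<forall>t\<in>S. (D j has_vector_derivative D (Suc j) t) (at t within S)) \<and>
          (\<forall>j\<le>k. continuous_on S (D j)))"

definition test_function :: "real \<Rightarrow> real \<Rightarrow> (real \<Rightarrow> real) \<Rightarrow> bool" where
  "test_function a b \<phi> \<longleftrightarrow>
     (\<forall>k t. (deriv ^^ k) \<phi> differentiable (at t)) \<and>
     (\<exists>K. compact K \<and> K \<subseteq> {a<..<b} \<and> (\<forall>t. t \<notin> K \<longrightarrow> \<phi> t = 0))"

definition has_weak_deriv ::
    "nat \<Rightarrow> real \<Rightarrow> real \<Rightarrow> (real \<Rightarrow> real) \<Rightarrow> (real \<Rightarrow> real) \<Rightarrow> bool" where
  "has_weak_deriv k a b g w \<longleftrightarrow>
     (\<forall>\<phi>. test_function a b \<phi> \<longrightarrow>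
        integral {a<..<b} (\<lambda>t. g t * (deriv ^^ k) \<phi> t)
          = (- 1) ^ k * integral {a<..<b} (\<lambda>t. w t * \<phi> t))"

text \<open>\<open>W\<^sup>p\<^sup>,\<^sup>1(a,b)\<close>: all weak derivatives up to order \<open>p\<close> exist and lie in \<open>L\<^sup>1(a,b)\<close>.\<close>

definition sobolev_W1 :: "nat \<Rightarrow> real \<Rightarrow> real \<Rightarrow> (real \<Rightarrow> real) set" where
  "sobolev_W1 p a b =
     {g. g absolutely_integrable_on {a<..<b} \<and>
         (\<forall>k\<in>{1..p}. \<exists>w. w absolutely_integrable_on {a<..<b} \<and> has_weak_deriv k a b g w)}"

text \<open>Weak derivatives in \<open>L\<^sup>1\<close> are unique up to a null set, so on \<open>sobolev_W1 p a b\<close> the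
  seminorm below does not depend on the representative that is picked.\<close>

definition weak_deriv :: "nat \<Rightarrow> real \<Rightarrow> real \<Rightarrow> (real \<Rightarrow> real) \<Rightarrow> (real \<Rightarrow> real)" where
  "weak_deriv k a b g =
     (SOME w. w absolutely_integrable_on {a<..<b} \<and> has_weak_deriv k a b g w)"

definition sobolev_seminorm :: "nat \<Rightarrow> real \<Rightarrow> real \<Rightarrow> (real \<Rightarrow> real) \<Rightarrow> real" where
  "sobolev_seminorm p a b g = integral {a<..<b} (\<lambda>t. \<bar>weak_deriv p a b g t\<bar>)"

definition AB_alpha :: "nat \<Rightarrow> real" where
  "AB_alpha m = (if m = 0 then 1 else if m = 1 then - 1 else 0)"

definition AB_beta :: "nat \<Rightarrow> nat \<Rightarrow> real" where
  "AB_beta M m =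
     (if 1 \<le> m \<and> m \<le> M
      then (- 1) ^ (m - 1) / (fact (m - 1) * fact (M - m)) *
           integral {0..1} (\<lambda>u::real. \<Prod>i\<in>{0..M - 1} - {m - 1}. u + real i)
      else 0)"

definition AB_discovery_poly :: "nat \<Rightarrow> complex poly" where
  "AB_discovery_poly M = (\<Sum>m=1..M. monom (complex_of_real (AB_beta M m)) (M - m))"

text \<open>For \<open>M \<ge> 2\<close> the polynomial has degree \<open>M - 1 \<ge> 1\<close>, so the set is finite and nonempty.\<close>

definition AB_rho :: "nat \<Rightarrow> real" where
  "AB_rho M = Max {cmod z | z. poly (AB_discovery_poly M) z = 0}"

definition step_size :: "real \<Rightarrow> nat \<Rightarrow> real" where
  "step_size T N = T / real N"

definition grid_state :: "(real \<Rightarrow> real ^ 'd) \<Rightarrow> real \<Rightarrow> nat \<Rightarrow> nat \<Rightarrow> real ^ 'd" where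
  "grid_state x T N n = x (real n * step_size T N)"

definition nonaux_loss ::
    "nat \<Rightarrow> (real \<Rightarrow> real ^ 'd) \<Rightarrow> 'd \<Rightarrow> real \<Rightarrow> nat \<Rightarrow> (real ^ 'd \<Rightarrow> real) \<Rightarrow> real" where
  "nonaux_loss M x i T N u =
     1 / real (N - M + 1) *
     (\<Sum>n=M..N. \<bar>(\<Sum>m=1..M. AB_beta M m * u (grid_state x T N (n - m)))
        - inverse (step_size T N) * (\<Sum>m=0..M. AB_alpha m * grid_state x T N (n - m) $ i)\<bar>\<^sup>2)"

definition trace_error ::
    "(real \<Rightarrow> real ^ 'd) \<Rightarrow> (real ^ 'd \<Rightarrow> real ^ 'd) \<Rightarrow> 'd \<Rightarrow> (real ^ 'd \<Rightarrow> real) \<Rightarrow> real \<Rightarrow> real" where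
  "trace_error x f i u t = u (x t) - f (x t) $ i"

definition trace_class ::
    "(real ^ 'd \<Rightarrow> real) set \<Rightarrow> (real \<Rightarrow> real ^ 'd) \<Rightarrow> (real ^ 'd \<Rightarrow> real ^ 'd) \<Rightarrow> 'd \<Rightarrow>
     real \<Rightarrow> nat \<Rightarrow> real \<Rightarrow> (real ^ 'd \<Rightarrow> real) set" where
  "trace_class A x f i T p R =
     {u \<in> A. trace_error x f i u \<in> sobolev_W1 p 0 T \<and>
             sobolev_seminorm p 0 T (trace_error x f i u) \<le> R}"

end

theory Submission
  imports Defs "HOL-Computational_Algebra.Fundamental_Theorem_Algebra"
begin

text \<open>
  Let \<open>g(t) = u(x(t)) - f(x(t))\<close> be the trace of the error, \<open>h = T/N\<close> and \<open>e\<^sub>n = g(n h)\<close>. The bound for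
  \<open>\<integral>|g|\<close> combines consistency and stability at the grid points with an interpolation estimate
  between them.

  Consistency: the Adams--Bashforth weights are the integrals over \<open>[0,1]\<close> of the Lagrange basis for
  the nodes \<open>0, -1, ..., -(M-1)\<close>, so the scheme is exact on polynomials of degree at most \<open>M\<close>, and
  Taylor expansion of the trajectory leaves a truncation error \<open>O(h\<^sup>M)\<close>
  (\<open>AB_truncation_error\<close>). Vanishing of the loss says that \<open>u\<close> satisfies every equation of the scheme
  exactly, hence \<open>\<Sum>\<^sub>m \<beta>\<^sub>m e\<^bsub>n-m\<^esub> = O(h\<^sup>M)\<close> for \<open>M \<le> n \<le> N\<close>.

  Stability: the characteristic polynomial of this recurrence is the discovery polynomial. Splitting
  off its roots one at a time reduces a recurrence to first-order ones \<open>y\<^bsub>n+1\<^esub> = \<lambda> y\<^sub>n + z\<^sub>n\<close> with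
  \<open>|\<lambda>| < 1\<close>, for which \<open>\<Sum>|y\<^sub>n| \<le> (|y\<^sub>0| + \<Sum>|z\<^sub>n|)/(1 - |\<lambda>|)\<close>. This gives
  \<open>h \<Sum>\<^bsub>n<N\<^esub> |e\<^sub>n| \<le> C (h E\<^sub>0 + T h\<^sup>M)\<close> (\<open>stable_recurrence_sum_le\<close>, \<open>AB_discovery_stable\<close>). Working with
  sums instead of maxima is what makes the initial errors enter with the factor \<open>h\<close>.

  Interpolation: the equations involve only \<open>e\<^sub>0, ..., e\<^bsub>N-1\<^esub>\<close>, so on each window \<open>[kh, (k+M)h]\<close> with
  \<open>k \<le> N - M\<close> the function \<open>g\<close> is compared with its interpolation polynomial at the first \<open>M\<close> grid points of the
  window. The difference at a point \<open>\<theta>\<close> is a functional \<open>\<Sum>\<^sub>j c\<^sub>j g(s\<^sub>j)\<close> that annihilates polynomials of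
  degree less than \<open>M\<close>. Such a functional is bounded by the integral of \<open>|g\<^sup>(\<^sup>M\<^sup>)|\<close>, and this follows
  from the definition of the weak derivative alone: a Peano kernel \<open>\<psi>\<close>, mollified so
  that it is a test function, satisfies \<open>\<psi>\<^sup>(\<^sup>M\<^sup>) = \<Sum>\<^sub>j c\<^sub>j \<eta>(\<cdot> - s\<^sub>j)\<close> with a narrow bump \<open>\<eta>\<close> of mass one
  (\<open>mollified_functional_bound\<close>, \<open>weak_derivative_functional_bound\<close>). The windows cover \<open>[0,T]\<close>
  and overlap at most \<open>M\<close> times, so summation over them yields \<open>integral_le_grid_sum\<close>.
\<close>

section \<open>Lagrange interpolation and antiderivatives of polynomials\<close>

definition lagrange_basis :: "'i set \<Rightarrow> ('i \<Rightarrow> real) \<Rightarrow> 'i \<Rightarrow> real \<Rightarrow> real" where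
  "lagrange_basis I s j v = (\<Prod>i\<in>I - {j}. (v - s i) / (s j - s i))"

text \<open>Both sides are polynomials in \<open>v\<close> of degree less than the number of nodes, and they agree at the
  nodes.\<close>

lemma lagrange_interpolation_exact:
  assumes fin: "finite I" and inj: "inj_on s I" and deg: "degree q < card I"
  shows "poly q v = (\<Sum>j\<in>I. poly q (s j) * lagrange_basis I s j v)"
proof -
  define L where "L j = (\<Prod>i\<in>I - {j}. smult (1 / (s j - s i)) [:- s i, 1:])" for j
  have polyL: "poly (L j) v = lagrange_basis I s j v" for j v
    unfolding L_def poly_prod lagrange_basis_def by (intro prod.cong) (auto simp: diff_divide_distrib)
  have degL: "degree (L j) < card I" if "j \<in> I" for j
  proof -
    have "degree (L j) \<le> (\<Sum>i\<in>I - {j}. degree (smult (1 / (s j - s i)) [:- s i, 1:]))"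
      unfolding L_def using fin by (intro degree_prod_sum_le[THEN order_trans] order_refl) auto
    also have "\<dots> \<le> (\<Sum>i\<in>I - {j}. 1)"
      by (intro sum_mono) (auto intro: order_trans[OF degree_smult_le])
    also have "\<dots> < card I"
      using that fin by (auto simp: card_gt_0_iff intro!: diff_less)
    finally show ?thesis .
  qed
  have at_nodes: "lagrange_basis I s j (s k) = (if k = j then 1 else 0)" if "j \<in> I" "k \<in> I" for j k
  proof (cases "k = j")
    case True
    have "lagrange_basis I s j (s k) = (\<Prod>i\<in>I - {j}. 1)"
      unfolding lagrange_basis_def
    proof (rule prod.cong)
      fix i assume "i \<in> I - {j}"
      then have "s j \<noteq> s i" using inj that by (metis DiffE inj_onD singletonI)
      then show "(s k - s i) / (s j - s i) = 1" using True by simp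
    qed simp
    then show ?thesis using True by simp
  next
    case False
    then show ?thesis
      unfolding lagrange_basis_def using fin that
      by (auto intro!: bexI[of _ k] simp: prod_zero_iff)
  qed
  define r where "r = (\<Sum>j\<in>I. smult (poly q (s j)) (L j))"
  have "degree r < card I"
  proof -
    have "card I > 0" using deg by linarith
    then show ?thesis unfolding r_def
      by (intro degree_sum_less) (auto intro: le_less_trans[OF degree_smult_le] degL)
  qed
  moreover have "poly q y = poly r y" if y: "y \<in> s ` I" for y
  proof -
    obtain k where k: "k \<in> I" "y = s k" using y by auto
    have "poly r y = (\<Sum>j\<in>I. poly q (s j) * (if k = j then 1 else 0))"
      unfolding r_def poly_sum k
      by (intro sum.cong) (auto simp: polyL at_nodes k(1))
    also have "\<dots> = (\<Sum>j\<in>I. if k = j then poly q (s j) else 0)"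
      by (intro sum.cong) auto
    also have "\<dots> = poly q y" using k fin by simp
    finally show ?thesis by simp
  qed
  ultimately have "q = r"
    by (intro poly_eqI_degree[where A = "s ` I"]) (use deg inj in \<open>auto simp: card_image\<close>)
  then have "poly q v = poly r v" by simp
  then show ?thesis by (simp add: r_def poly_sum polyL)
qed

lemma poly_antiderivative:
  fixes q :: "real poly"
  obtains Q where "pderiv Q = q" "degree Q \<le> Suc (degree q)" 
proof
  define Q where "Q = (\<Sum>i\<le>degree q. monom (coeff q i / real (Suc i)) (Suc i))"
  have "pderiv Q = (\<Sum>i\<le>degree q. monom (coeff q i) i)"
    unfolding Q_def higher_pderiv_sum[of 1, simplified] by (simp add: pderiv_monom)
  then show "pderiv Q = q" by (simp add: poly_as_sum_of_monoms)
  show "degree Q \<le> Suc (degree q)"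
    unfolding Q_def by (intro degree_sum_le) (auto intro: order_trans[OF degree_monom_le])
qed

section \<open>Linear recurrences whose characteristic roots lie in the unit disc\<close>

text \<open>The operator \<open>q(S)\<close>, where \<open>S\<close> shifts a sequence by one place. Products of polynomials become
  compositions of operators, which is why a factorisation of \<open>q\<close> solves the recurrence step by
  step.\<close>

definition shift_op :: "complex poly \<Rightarrow> (nat \<Rightarrow> complex) \<Rightarrow> nat \<Rightarrow> complex" where
  "shift_op q e n = (\<Sum>k\<le>degree q. coeff q k * e (n + k))"

lemma shift_op_linear_factor:
  assumes "q \<noteq> 0"
  shows "shift_op ([:-z, 1:] * q) e n = shift_op q (\<lambda>k. e (Suc k) - z * e k) n"
proof -
  have "degree ([:-z, 1:] * q) = Suc (degree q)"
    using assms by (subst degree_mult_eq) auto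
  then have "shift_op ([:-z, 1:] * q) e n
      = (\<Sum>k\<le>Suc (degree q). ((case k of 0 \<Rightarrow> 0 | Suc j \<Rightarrow> coeff q j) - z * coeff q k) * e (n + k))"
    unfolding shift_op_def
    by (intro sum.cong) (auto simp: coeff_pCons split: nat.splits)
  also have "\<dots> = (\<Sum>k\<le>Suc (degree q). (case k of 0 \<Rightarrow> 0 | Suc j \<Rightarrow> coeff q j) * e (n + k))
                 - (\<Sum>k\<le>Suc (degree q). z * coeff q k * e (n + k))"
    by (simp add: algebra_simps sum_subtractf)
  also have "(\<Sum>k\<le>Suc (degree q). (case k of 0 \<Rightarrow> 0 | Suc j \<Rightarrow> coeff q j) * e (n + k))
      = (\<Sum>k\<le>degree q. coeff q k * e (Suc (n + k)))"
    by (subst sum.atMost_Suc_shift) simp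
  also have "(\<Sum>k\<le>Suc (degree q). z * coeff q k * e (n + k))
      = (\<Sum>k\<le>degree q. coeff q k * (z * e (n + k)))"
    by (simp add: coeff_eq_0 mult_ac)
  finally show ?thesis
    unfolding shift_op_def by (simp add: sum_subtractf algebra_simps)
qed

lemma first_order_recurrence_sum_le:
  fixes e :: "nat \<Rightarrow> complex"
  assumes "cmod z < 1"
  shows "(1 - cmod z) * (\<Sum>n<Suc K. cmod (e n))
      \<le> cmod (e 0) + (\<Sum>n<K. cmod (e (Suc n) - z * e n))"
proof -
  have "cmod (e (Suc n)) \<le> cmod z * cmod (e n) + cmod (e (Suc n) - z * e n)" for n
    using norm_triangle_ineq[of "z * e n" "e (Suc n) - z * e n"] by (simp add: norm_mult)
  then have "(\<Sum>n<K. cmod (e (Suc n)))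
      \<le> (\<Sum>n<K. cmod z * cmod (e n) + cmod (e (Suc n) - z * e n))"
    by (intro sum_mono)
  then have 1: "(\<Sum>n<K. cmod (e (Suc n)))
      \<le> cmod z * (\<Sum>n<K. cmod (e n)) + (\<Sum>n<K. cmod (e (Suc n) - z * e n))"
    by (simp add: sum.distrib sum_distrib_left)
  have 2: "cmod z * (\<Sum>n<K. cmod (e n)) \<le> cmod z * (\<Sum>n<Suc K. cmod (e n))"
    by (intro mult_left_mono) auto
  have 3: "(\<Sum>n<Suc K. cmod (e n)) = cmod (e 0) + (\<Sum>n<K. cmod (e (Suc n)))"
    by (rule sum.lessThan_Suc_shift)
  show ?thesis using 1 2 3 unfolding left_diff_distrib by linarith
qed

text \<open>The induction removes one linear factor \<open>S - z\<close>. With \<open>y = (S - z) e\<close>, the induction hypothesis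
  applies to \<open>y\<close> and the cofactor, the first values of \<open>y\<close> are controlled by those of \<open>e\<close>, and
  \<open>first_order_recurrence_sum_le\<close> recovers \<open>e\<close> from \<open>y\<close>. The constant does not depend on the length
  of the sequence.\<close>

lemma stable_recurrence_sum_le:
  assumes "q \<noteq> 0" "\<And>z. poly q z = 0 \<Longrightarrow> cmod z < 1"
  shows "\<exists>C>0. \<forall>K e. (\<Sum>n<K + degree q. cmod (e n))
      \<le> C * ((\<Sum>n<degree q. cmod (e n)) + (\<Sum>n<K. cmod (shift_op q e n)))"
  using assms
proof (induction "degree q" arbitrary: q)
  case 0
  then obtain c where c: "q = [:c:]" by (metis degree_eq_zeroE)
  with 0 have c0: "c \<noteq> 0" by auto
  have "(\<Sum>n<K + degree q. cmod (e n))
      \<le> 1 / cmod c * ((\<Sum>n<degree q. cmod (e n)) + (\<Sum>n<K. cmod (shift_op q e n)))" for K e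
    using c c0 by (simp add: shift_op_def norm_mult flip: sum_distrib_left)
  then show ?case using c0 by (intro exI[of _ "1 / cmod c"]) auto
next
  case (Suc d)
  then obtain z where z: "poly q z = 0"
    using fundamental_theorem_of_algebra[of q] constant_degree[of q] by auto
  then obtain r where r: "q = [:-z, 1:] * r" using poly_eq_0_iff_dvd by (metis dvdE)
  have r0: "r \<noteq> 0" using r Suc.prems by auto
  have d: "degree r = d" using Suc.hyps(2) r r0 by (simp add: degree_mult_eq del: mult_pCons_left)
  have z1: "cmod z < 1" using Suc.prems z by auto
  obtain C where C: "C > 0" "\<And>K e. (\<Sum>n<K + degree r. cmod (e n))
      \<le> C * ((\<Sum>n<degree r. cmod (e n)) + (\<Sum>n<K. cmod (shift_op r e n)))"
    using Suc.hyps(1)[of r] d r0 Suc.prems(2) r by (metis mult_eq_0_iff poly_mult)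
  define C' where "C' = (1 + 2 * C) / (1 - cmod z)"
  have "(\<Sum>n<K + degree q. cmod (e n))
      \<le> C' * ((\<Sum>n<degree q. cmod (e n)) + (\<Sum>n<K. cmod (shift_op q e n)))" for K e
  proof -
    define y where "y n = e (Suc n) - z * e n" for n
    define S0 where "S0 = (\<Sum>n<Suc d. cmod (e n))"
    define S1 where "S1 = (\<Sum>n<K. cmod (shift_op q e n))"
    have "cmod (y n) \<le> cmod (e (Suc n)) + cmod (e n)" for n
    proof -
      have "cmod (z * e n) \<le> cmod (e n)"
        using z1 by (simp add: norm_mult mult_left_le_one_le)
      then show ?thesis using norm_triangle_ineq4[of "e (Suc n)" "z * e n"] by (simp add: y_def)
    qed
    then have "(\<Sum>n<d. cmod (y n)) \<le> (\<Sum>n<d. cmod (e (Suc n)) + cmod (e n))"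
      by (intro sum_mono)
    also have "\<dots> = (\<Sum>n<d. cmod (e (Suc n))) + (\<Sum>n<d. cmod (e n))"
      by (rule sum.distrib)
    also have "\<dots> \<le> 2 * S0"
    proof -
      have "(\<Sum>n<d. cmod (e (Suc n))) \<le> S0" "(\<Sum>n<d. cmod (e n)) \<le> S0"
        unfolding S0_def by (subst sum.lessThan_Suc_shift, simp) simp
      then show ?thesis by simp
    qed
    finally have y0: "(\<Sum>n<d. cmod (y n)) \<le> 2 * S0" .
    have yq: "shift_op r y n = shift_op q e n" for n
      unfolding r y_def using shift_op_linear_factor[OF r0] by simp
    have "(1 - cmod z) * (\<Sum>n<Suc (K + d). cmod (e n))
        \<le> cmod (e 0) + (\<Sum>n<K + d. cmod (y n))"
      unfolding y_def by (rule first_order_recurrence_sum_le[OF z1])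
    also have "\<dots> \<le> S0 + C * (2 * S0 + S1)"
    proof (rule add_mono)
      show "cmod (e 0) \<le> S0" unfolding S0_def
        using member_le_sum[of 0 "{..<Suc d}" "\<lambda>n. cmod (e n)"] by simp
      have "(\<Sum>n<K + d. cmod (y n)) \<le> C * ((\<Sum>n<d. cmod (y n)) + S1)"
        using C(2)[of y K] by (simp add: d yq S1_def)
      also have "\<dots> \<le> C * (2 * S0 + S1)" using y0 C(1) by simp
      finally show "(\<Sum>n<K + d. cmod (y n)) \<le> C * (2 * S0 + S1)" .
    qed
    also have "\<dots> \<le> (1 + 2 * C) * (S0 + S1)"
    proof -
      have "0 \<le> S1" by (auto simp: S1_def intro: sum_nonneg)
      then have "0 \<le> C * S1" "0 \<le> S1" using C(1) by simp_all
      then show ?thesis by (simp add: algebra_simps)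
    qed
    finally have "(\<Sum>n<Suc (K + d). cmod (e n)) \<le> C' * (S0 + S1)"
      using z1 unfolding C'_def by (simp add: field_simps)
    then show ?thesis by (simp add: S0_def S1_def flip: Suc.hyps(2))
  qed
  moreover have "C' > 0" using z1 C(1) unfolding C'_def by simp
  ultimately show ?case by blast
qed

section \<open>Smooth functions and mollified truncated powers\<close>

definition smooth :: "(real \<Rightarrow> real) \<Rightarrow> bool" where
  "smooth \<phi> \<longleftrightarrow> (\<forall>k t. (deriv ^^ k) \<phi> differentiable (at t))"

text \<open>A class of functions that is closed under differentiation contains only smooth functions. This
  replaces formulas for the higher derivatives of products and compositions: it is enough to name a
  suitable class.\<close>

lemma smooth_coinduct:
  assumes "\<phi> \<in> S"
    and step: "\<And>g. g \<in> S \<Longrightarrow> \<exists>g'\<in>S. \<forall>t. (g has_real_derivative g' t) (at t)"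
  shows "smooth \<phi>"
proof -
  have "(deriv ^^ k) \<phi> \<in> S" for k
  proof (induction k)
    case (Suc k)
    then obtain g' where g': "g' \<in> S" "\<forall>t. ((deriv ^^ k) \<phi> has_real_derivative g' t) (at t)"
      using step by blast
    then have "deriv ((deriv ^^ k) \<phi>) = g'" by (auto intro: DERIV_imp_deriv)
    then show ?case using g'(1) by simp
  qed (use assms in simp)
  then show ?thesis
    unfolding smooth_def using step real_differentiable_def by blast
qed

lemma smooth_has_derivative:
  "smooth f \<Longrightarrow> (f has_real_derivative deriv f t) (at t)"
  unfolding smooth_def DERIV_deriv_iff_real_differentiable by (metis funpow_0)

lemma smooth_deriv: "smooth f \<Longrightarrow> smooth (deriv f)"
  unfolding smooth_def by (metis funpow_Suc_right o_apply)

lemma smooth_continuous_on: "smooth f \<Longrightarrow> continuous_on S f"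
  by (meson DERIV_isCont continuous_at_imp_continuous_on smooth_has_derivative)

lemma smooth_if_derivative_smooth:
  assumes "smooth f" "\<And>t. (F has_real_derivative f t) (at t)"
  shows "smooth F"
  by (rule smooth_coinduct[where S = "insert F (Collect smooth)"])
     (use assms smooth_has_derivative smooth_deriv in blast)+

text \<open>Sums are included because the Leibniz rule turns a product into a sum of two products.\<close>

inductive_set smooth_product_sums :: "(real \<Rightarrow> real) set" where
  prod: "smooth f \<Longrightarrow> smooth g \<Longrightarrow> (\<lambda>t. f t * g t) \<in> smooth_product_sums"
| add: "f \<in> smooth_product_sums \<Longrightarrow> g \<in> smooth_product_sums
    \<Longrightarrow> (\<lambda>t. f t + g t) \<in> smooth_product_sums"

lemma smooth_mult:
  assumes "smooth f" "smooth g"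
  shows "smooth (\<lambda>t. f t * g t)"
proof (rule smooth_coinduct[where S = smooth_product_sums])
  fix h assume "h \<in> smooth_product_sums"
  then show "\<exists>h'\<in>smooth_product_sums. \<forall>t. (h has_real_derivative h' t) (at t)"
  proof induction
    case (prod f g)
    have "(\<lambda>t. deriv f t * g t + f t * deriv g t) \<in> smooth_product_sums"
      using prod by (intro smooth_product_sums.intros smooth_deriv)
    moreover have "((\<lambda>t. f t * g t) has_real_derivative deriv f t * g t + f t * deriv g t) (at t)" for t
      using prod[THEN smooth_has_derivative] by (auto intro!: derivative_eq_intros)
    ultimately show ?case by (intro bexI) auto
  next
    case (add f g)
    then obtain f' g' where "f' \<in> smooth_product_sums" "g' \<in> smooth_product_sums"
      "\<forall>t. (f has_real_derivative f' t) (at t)" "\<forall>t. (g has_real_derivative g' t) (at t)"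
      by blast
    then show ?case
      by (intro bexI[of _ "\<lambda>t. f' t + g' t"])
         (auto intro!: derivative_eq_intros smooth_product_sums.add)
  qed
qed (rule smooth_product_sums.prod[OF assms])

lemma smooth_affine:
  assumes "smooth f"
  shows "smooth (\<lambda>t. c * f (a + b * t))"
proof (rule smooth_coinduct[where S = "{\<lambda>t. c * f (a + b * t) |c f. smooth f}"])
  fix h assume "h \<in> {\<lambda>t. c * f (a + b * t) |c f. smooth f}"
  then obtain c f where h: "h = (\<lambda>t. c * f (a + b * t))" and f: "smooth f" by blast
  have lin: "((\<lambda>t. a + b * t) has_real_derivative b) (at t)" for t
    by (auto intro!: derivative_eq_intros)
  have "(h has_real_derivative (c * b) * deriv f (a + b * t)) (at t)" for t
    unfolding h
    by (rule DERIV_cong[OF DERIV_cmult[OF DERIV_chain2[OF smooth_has_derivative[OF f] lin]]]) simp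
  moreover have "(\<lambda>t. (c * b) * deriv f (a + b * t)) \<in> {\<lambda>t. c * f (a + b * t) |c f. smooth f}"
    using smooth_deriv[OF f] by blast
  ultimately show "\<exists>h'\<in>{\<lambda>t. c * f (a + b * t) |c f. smooth f}.
      \<forall>t. (h has_real_derivative h' t) (at t)" by (intro bexI) auto
qed (use assms in blast)

lemma smooth_sum_translates:
  assumes "smooth f"
  shows "smooth (\<lambda>t. \<Sum>j\<in>J. c j * f (t - s j))"
proof (rule smooth_coinduct[where S = "{\<lambda>t. \<Sum>j\<in>J. c j * f (t - s j) |f. smooth f}"])
  fix h assume "h \<in> {\<lambda>t. \<Sum>j\<in>J. c j * f (t - s j) |f. smooth f}"
  then obtain f where h: "h = (\<lambda>t. \<Sum>j\<in>J. c j * f (t - s j))" and f: "smooth f" by blast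
  have "((\<lambda>t. t - r) has_real_derivative 1) (at t)" for t r
    by (auto intro!: derivative_eq_intros)
  from DERIV_chain2[OF smooth_has_derivative[OF f] this]
  have "((\<lambda>t. f (t - r)) has_real_derivative deriv f (t - r)) (at t)" for t r
    by simp
  then have "(h has_real_derivative (\<Sum>j\<in>J. c j * deriv f (t - s j))) (at t)" for t
    unfolding h by (intro DERIV_sum DERIV_cmult)
  moreover have "(\<lambda>t. \<Sum>j\<in>J. c j * deriv f (t - s j)) \<in> {\<lambda>t. \<Sum>j\<in>J. c j * f (t - s j) |f. smooth f}"
    using smooth_deriv[OF f] by blast
  ultimately show "\<exists>h'\<in>{\<lambda>t. \<Sum>j\<in>J. c j * f (t - s j) |f. smooth f}.
      \<forall>t. (h has_real_derivative h' t) (at t)"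
    by (intro bexI) auto
qed (use assms in blast)

text \<open>The classical function \<open>exp(-1/t)\<close> that is flat at \<open>0\<close>, with a polynomial factor in \<open>1/t\<close> to make the
  family closed under differentiation.\<close>

definition flat :: "real poly \<Rightarrow> real \<Rightarrow> real" where
  "flat P t = (if t > 0 then poly P (1 / t) * exp (- (1 / t)) else 0)"

lemma poly_div_exp_tendsto_0: "((\<lambda>y::real. poly P y / exp y) \<longlongrightarrow> 0) at_top"
proof -
  have "((\<lambda>y. \<Sum>i\<le>degree P. coeff P i * (y ^ i / exp y)) \<longlongrightarrow> (\<Sum>i\<le>degree P. coeff P i * 0)) at_top"
    by (intro tendsto_intros tendsto_power_div_exp_0)
  then show ?thesis by (simp add: poly_altdef sum_divide_distrib)
qed

lemma flat_has_derivative: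
  "(flat P has_real_derivative flat ([:0, 0, 1:] * (P - pderiv P)) t) (at t)"
proof -
  consider "t > 0" | "t < 0" | "t = 0" by linarith
  then show ?thesis
  proof cases
    case 1
    have "((\<lambda>t. poly P (1 / t) * exp (- (1 / t))) has_real_derivative
        flat ([:0, 0, 1:] * (P - pderiv P)) t) (at t)"
      using 1 unfolding flat_def
      by (auto intro!: derivative_eq_intros DERIV_chain2[OF poly_DERIV]
          simp: field_simps power2_eq_square)
    then show ?thesis
      by (rule DERIV_cong_ev[THEN iffD1, rotated -1])
         (use 1 in \<open>auto simp: flat_def eventually_nhds intro!: exI[of _ "{0<..}"]\<close>)
  next
    case 2
    have "((\<lambda>t. 0) has_real_derivative flat ([:0, 0, 1:] * (P - pderiv P)) t) (at t)"
      using 2 by (simp add: flat_def)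
    then show ?thesis
      by (rule DERIV_cong_ev[THEN iffD1, rotated -1])
         (use 2 in \<open>auto simp: flat_def eventually_nhds intro!: exI[of _ "{..<0}"]\<close>)
  next
    case 3
    have "((\<lambda>h. flat P h / h) \<longlongrightarrow> 0) (at_left 0)"
      by (rule tendsto_eventually) (auto simp: eventually_at_filter flat_def)
    \<comment> \<open>At the origin the right difference quotient is \<open>y P(y) exp(-y)\<close> with \<open>y = 1/h\<close>.\<close>
    moreover have "((\<lambda>h. flat P h / h) \<longlongrightarrow> 0) (at_right 0)"
    proof -
      have "((\<lambda>h::real. poly ([:0, 1:] * P) (inverse h) / exp (inverse h)) \<longlongrightarrow> 0) (at_right 0)"
        by (rule filterlim_compose[OF poly_div_exp_tendsto_0 filterlim_inverse_at_top_right])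
      then show ?thesis
        by (rule Lim_transform_eventually)
           (auto simp: eventually_at_filter flat_def exp_minus field_simps)
    qed
    ultimately have "((\<lambda>h. flat P h / h) \<longlongrightarrow> 0) (at 0)"
      by (rule filterlim_split_at)
    then show ?thesis using 3 by (simp add: DERIV_def flat_def)
  qed
qed

lemma smooth_flat: "smooth (flat P)"
  by (rule smooth_coinduct[where S = "range flat"]) (use flat_has_derivative in auto)

lemma smooth_bump_exists:
  fixes \<epsilon> :: real
  assumes "\<epsilon> > 0"
  obtains \<eta> where "smooth \<eta>" "\<And>t. \<eta> t \<ge> 0" "\<And>t. \<epsilon> \<le> \<bar>t\<bar> \<Longrightarrow> \<eta> t = 0"
    "(\<eta> has_integral 1) {-\<epsilon>..\<epsilon>}"
proof -
  \<comment> \<open>One factor vanishes for \<open>t \<le> -\<epsilon>\<close>, the other for \<open>t \<ge> \<epsilon>\<close>.\<close>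
  define b where "b t = flat 1 (\<epsilon> + t) * flat 1 (\<epsilon> - t)" for t
  have sm: "smooth b"
    using smooth_mult[OF smooth_affine[OF smooth_flat, of 1 1 \<epsilon> 1]
        smooth_affine[OF smooth_flat, of 1 1 \<epsilon> "-1"]]
    unfolding b_def by simp
  have nn: "b t \<ge> 0" for t by (simp add: b_def flat_def)
  have "b integrable_on {-\<epsilon>..\<epsilon>}"
    by (intro integrable_continuous_real smooth_continuous_on sm)
  then have I: "(b has_integral integral {-\<epsilon>..\<epsilon>} b) (cbox (-\<epsilon>) \<epsilon>)"
    by (simp add: integrable_integral)
  have "integral {-\<epsilon>..\<epsilon>} b \<noteq> 0"
  proof
    assume "integral {-\<epsilon>..\<epsilon>} b = 0"
    then have "b 0 = 0"
      using has_integral_0_cbox_imp_0[of "-\<epsilon>" \<epsilon> b 0] I assms nn smooth_continuous_on[OF sm]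
      by (auto simp: box_real)
    then show False using assms by (simp add: b_def flat_def)
  qed
  then have pos: "integral {-\<epsilon>..\<epsilon>} b > 0"
    using integral_nonneg[OF \<open>b integrable_on _\<close>] nn by (simp add: less_le)
  show ?thesis
  proof (rule that[of "\<lambda>t. (1 / integral {-\<epsilon>..\<epsilon>} b) * b t"])
    show "smooth (\<lambda>t. (1 / integral {-\<epsilon>..\<epsilon>} b) * b t)"
      using smooth_affine[OF sm, of "1 / integral {-\<epsilon>..\<epsilon>} b" 0 1] by simp
    show "((\<lambda>t. (1 / integral {-\<epsilon>..\<epsilon>} b) * b t) has_integral 1) {-\<epsilon>..\<epsilon>}"
      using has_integral_mult_right[OF I, of "1 / integral {-\<epsilon>..\<epsilon>} b"] pos by simp
  qed (use nn pos in \<open>auto simp: b_def flat_def\<close>)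
qed

text \<open>A lower limit \<open>c < t\<close> can replace \<open>a\<close> because \<open>f\<close> vanishes to the left of \<open>a\<close>; this gives a
  two-sided derivative at every real \<open>t\<close>, also for \<open>t \<le> a\<close>.\<close>

lemma antiderivative_of_left_vanishing:
  fixes f :: "real \<Rightarrow> real"
  assumes cont: "continuous_on UNIV f" and zero: "\<And>t. t \<le> a \<Longrightarrow> f t = 0"
  shows "((\<lambda>t. integral {a..t} f) has_real_derivative f t) (at t)"
proof -
  define c where "c = min a t - 1"
  have eq: "integral {a..s} f = integral {c..s} f" for s
  proof (cases "a \<le> s")
    case True
    have "integral {c..a} f = 0"
      using zero integral_cong[of "{c..a}" f "\<lambda>_. 0"] by simp
    moreover have "integral {c..a} f + integral {a..s} f = integral {c..s} f"
      by (intro Henstock_Kurzweil_Integration.integral_combine integrable_continuous_real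
          continuous_on_subset[OF cont]) (use True in \<open>auto simp: c_def\<close>)
    ultimately show ?thesis by simp
  next
    case False
    have "integral {c..s} f = integral {c..s} (\<lambda>_. 0)"
      by (rule integral_cong) (use zero False in auto)
    then show ?thesis using False by simp
  qed
  have "((\<lambda>s. integral {c..s} f) has_real_derivative f t) (at t within {c..t + 1})"
    by (intro integral_has_real_derivative continuous_on_subset[OF cont]) (auto simp: c_def)
  moreover have "at t within {c..t + 1} = at t"
    by (rule at_within_Icc_at) (auto simp: c_def)
  ultimately show ?thesis by (simp add: eq)
qed

text \<open>Here \<open>H 0\<close> is a bump of mass one on \<open>[-\<epsilon>, \<epsilon>]\<close> and \<open>H k\<close> is its \<open>k\<close>-fold antiderivative from the
  left, a smooth version of the truncated power \<open>t\<^sub>+\<^bsup>k-1\<^esup>/(k-1)!\<close>. For \<open>k \<ge> 1\<close> it is, like the truncated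
  power, zero on the left, a polynomial of degree less than \<open>k\<close> on the right, and of size at most
  \<open>L\<^bsup>k-1\<^esup>\<close> at distance \<open>L\<close> from the start of its support.\<close>

lemma mollified_truncated_powers:
  fixes \<epsilon> :: real
  assumes eps: "\<epsilon> > 0"
  obtains H :: "nat \<Rightarrow> real \<Rightarrow> real" where
    "\<And>k. smooth (H k)"
    "\<And>k t. (H (Suc k) has_real_derivative H k t) (at t)"
    "\<And>k t. 0 \<le> H k t"
    "\<And>k t. t \<le> -\<epsilon> \<Longrightarrow> H k t = 0"
    "\<And>t. \<epsilon> \<le> t \<Longrightarrow> H 0 t = 0"
    "H (Suc 0) \<epsilon> = 1"
    "\<And>k t L. t + \<epsilon> \<le> L \<Longrightarrow> 0 \<le> L \<Longrightarrow> H (Suc k) t \<le> L ^ k"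
    "\<And>k. \<exists>q. degree q \<le> k \<and> (\<forall>t\<ge>\<epsilon>. H (Suc k) t = poly q t)"
proof -
  obtain \<eta> where \<eta>: "smooth \<eta>" "\<And>t. \<eta> t \<ge> 0" "\<And>t. \<epsilon> \<le> \<bar>t\<bar> \<Longrightarrow> \<eta> t = 0"
    "(\<eta> has_integral 1) {-\<epsilon>..\<epsilon>}"
    using smooth_bump_exists[OF eps] by metis
  define H where "H = rec_nat \<eta> (\<lambda>_ h t. integral {-\<epsilon>..t} h)"
  have H0: "H 0 = \<eta>" and HS: "H (Suc k) = (\<lambda>t. integral {-\<epsilon>..t} (H k))" for k
    by (simp_all add: H_def)
  have left: "H k t = 0" if "t \<le> -\<epsilon>" for k t
  proof (cases k)
    case 0
    then show ?thesis using \<eta>(3)[of t] that eps by (simp add: H0)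
  next
    case (Suc m)
    have "integral {-\<epsilon>..t} (H m) = 0"
      using that by (cases "t = -\<epsilon>") auto
    then show ?thesis by (simp add: Suc HS)
  qed
  have sm: "smooth (H k)" for k
  proof (induction k)
    case (Suc k)
    then show ?case
      unfolding HS
      by (rule smooth_if_derivative_smooth)
         (intro antiderivative_of_left_vanishing smooth_continuous_on Suc left)
  qed (simp add: H0 \<eta>)
  have int: "H k integrable_on {a..b}" for k a b
    by (intro integrable_continuous_real smooth_continuous_on sm)
  have der: "(H (Suc k) has_real_derivative H k t) (at t)" for k t
    unfolding HS
    by (intro antiderivative_of_left_vanishing smooth_continuous_on sm left)
  have nonneg: "0 \<le> H k t" for k t
    by (induction k arbitrary: t) (auto simp: H0 HS \<eta> intro!: integral_nonneg int)
  have right0: "H 0 t = 0" if "\<epsilon> \<le> t" for t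
    using \<eta>(3)[of t] that by (simp add: H0)
  have H1: "H (Suc 0) t = 1" if "\<epsilon> \<le> t" for t
  proof -
    have "integral {-\<epsilon>..\<epsilon>} (H 0) + integral {\<epsilon>..t} (H 0) = integral {-\<epsilon>..t} (H 0)"
      by (intro Henstock_Kurzweil_Integration.integral_combine int) (use that eps in auto)
    moreover have "integral {\<epsilon>..t} (H 0) = integral {\<epsilon>..t} (\<lambda>_. 0)"
      by (rule integral_cong) (use right0 in auto)
    moreover have "integral {-\<epsilon>..\<epsilon>} (H 0) = 1"
      using \<eta>(4) by (simp add: H0 integral_unique)
    ultimately show ?thesis by (simp add: HS)
  qed
  have bound: "H (Suc k) t \<le> L ^ k" if "t + \<epsilon> \<le> L" "0 \<le> L" for k t L
    using that
  proof (induction k arbitrary: t)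
    case 0
    have "H (Suc 0) t \<le> H (Suc 0) (max t \<epsilon>)"
      unfolding HS by (intro integral_subset_le int) (auto simp: nonneg)
    then show ?case using H1[of "max t \<epsilon>"] by simp
  next
    case (Suc k)
    show ?case
    proof (cases "t \<le> -\<epsilon>")
      case True
      then show ?thesis using left Suc.prems by simp
    next
      case False
      have "H (Suc (Suc k)) t = integral {-\<epsilon>..t} (H (Suc k))" by (simp add: HS[of "Suc k"])
      also have "\<dots> \<le> integral {-\<epsilon>..t} (\<lambda>_. L ^ k)"
        by (intro integral_le int integrable_const_ivl) (use Suc in auto)
      also have "\<dots> = (t + \<epsilon>) * L ^ k" using False by simp
      also have "\<dots> \<le> L * L ^ k" using Suc.prems by (intro mult_right_mono) auto
      finally show ?thesis by simp
    qed
  qed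
  have right: "\<exists>q. degree q \<le> k \<and> (\<forall>t\<ge>\<epsilon>. H (Suc k) t = poly q t)" for k
  proof (induction k)
    case 0
    then show ?case using H1 by (intro exI[of _ 1]) auto
  next
    case (Suc k)
    then obtain q where q: "degree q \<le> k" "\<And>t. t \<ge> \<epsilon> \<Longrightarrow> H (Suc k) t = poly q t" by blast
    obtain Q where Q: "pderiv Q = q" "degree Q \<le> Suc (degree q)" using poly_antiderivative .
    define Q' where "Q' = Q + [:H (Suc (Suc k)) \<epsilon> - poly Q \<epsilon>:]"
    have "degree Q' \<le> Suc k"
      unfolding Q'_def using Q(2) q(1) by (intro degree_add_le) auto
    moreover have "H (Suc (Suc k)) t = poly Q' t" if "t \<ge> \<epsilon>" for t
    proof -
      have "(H (Suc k) has_integral H (Suc (Suc k)) t - H (Suc (Suc k)) \<epsilon>) {\<epsilon>..t}"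
        by (rule fundamental_theorem_of_calculus[OF that])
           (use der[of "Suc k"] in \<open>auto simp: has_real_derivative_iff_has_vector_derivative[symmetric]
              intro: has_field_derivative_at_within\<close>)
      moreover have "(poly q has_integral poly Q t - poly Q \<epsilon>) {\<epsilon>..t}"
        by (rule fundamental_theorem_of_calculus[OF that])
           (use poly_DERIV[of Q] Q(1) in \<open>auto simp: has_real_derivative_iff_has_vector_derivative[symmetric]
              intro: has_field_derivative_at_within\<close>)
      then have "(H (Suc k) has_integral poly Q t - poly Q \<epsilon>) {\<epsilon>..t}"
        by (rule has_integral_eq[rotated]) (use q(2) in auto)
      ultimately have "H (Suc (Suc k)) t - H (Suc (Suc k)) \<epsilon> = poly Q t - poly Q \<epsilon>"
        by (rule has_integral_unique)
      then show ?thesis by (simp add: Q'_def)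
    qed
    ultimately show ?case by blast
  qed
  show ?thesis
    by (rule that[of H]) (use sm der nonneg left right0 H1 bound right in auto)
qed

section \<open>Functionals annihilating polynomials, and weak derivatives\<close>

lemma has_integral_vanishing_outside:
  fixes f :: "real \<Rightarrow> real"
  assumes "f integrable_on {a..b}" "A < a" "b < B"
    and "\<And>t. t < a \<Longrightarrow> f t = 0" "\<And>t. b < t \<Longrightarrow> f t = 0"
  shows "(f has_integral integral {a..b} f) {A<..<B}"
proof (rule has_integral_on_superset[OF integrable_integral[OF assms(1)]])
  show "f t = 0" if "t \<notin> {a..b}" for t using that assms(4,5)[of t] by force
qed (use assms in auto)

text \<open>The test function is the mollified Peano kernel \<open>\<psi> = \<Sum>\<^sub>j c\<^sub>j H p (\<cdot> - s\<^sub>j)\<close>. To the right of all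
  nodes every summand is the same polynomial of degree less than \<open>p\<close>, translated by \<open>s\<^sub>j\<close>, so the
  annihilation hypothesis makes \<open>\<psi>\<close> vanish there and \<open>\<psi>\<close> has compact support. Pairing \<open>g\<close> with
  the \<open>p\<close>-th derivative of \<open>\<psi>\<close> averages \<open>g\<close> around the nodes. The numbers \<open>v j\<close> stand for the values that these averages
  approximate; they are kept separate from \<open>g (s j)\<close> because the nodes are moved
  in \<open>weak_derivative_functional_bound\<close>.\<close>

lemma mollified_functional_bound:
  fixes g w :: "real \<Rightarrow> real"
  assumes p: "1 \<le> p" and weak: "has_weak_deriv p A B g w"
    and w: "w absolutely_integrable_on {A<..<B}" and g: "continuous_on {A..B} g"
    and ab: "A < a" "a \<le> b" "b < B" and eps: "0 < \<epsilon>" and fin: "finite J"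
    and s: "\<And>j. j \<in> J \<Longrightarrow> a \<le> s j - \<epsilon>" "\<And>j. j \<in> J \<Longrightarrow> s j + \<epsilon> \<le> b"
    and annih: "\<And>q. degree q < p \<Longrightarrow> (\<Sum>j\<in>J. c j * poly q (s j)) = 0"
    and close: "\<And>j t. j \<in> J \<Longrightarrow> \<bar>t - s j\<bar> \<le> \<epsilon> \<Longrightarrow> \<bar>g t - v j\<bar> \<le> e"
  shows "\<bar>\<Sum>j\<in>J. c j * v j\<bar>
      \<le> (\<Sum>j\<in>J. \<bar>c j\<bar>) * ((b - a) ^ (p - 1) * integral {a..b} (\<lambda>t. \<bar>w t\<bar>) + e)"
proof -
  obtain H where sm: "\<And>k. smooth (H k)"
    and der: "\<And>k t. (H (Suc k) has_real_derivative H k t) (at t)"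
    and nonneg: "\<And>k t. 0 \<le> H k t"
    and left: "\<And>k t. t \<le> -\<epsilon> \<Longrightarrow> H k t = 0"
    and right0: "\<And>t. \<epsilon> \<le> t \<Longrightarrow> H 0 t = 0"
    and mass: "H (Suc 0) \<epsilon> = 1"
    and bound: "\<And>k t L. t + \<epsilon> \<le> L \<Longrightarrow> 0 \<le> L \<Longrightarrow> H (Suc k) t \<le> L ^ k"
    and right: "\<And>k. \<exists>q. degree q \<le> k \<and> (\<forall>t\<ge>\<epsilon>. H (Suc k) t = poly q t)"
    using mollified_truncated_powers[OF eps] by metis
  obtain m where m: "p = Suc m" using p by (metis Suc_le_D One_nat_def)
  define \<psi> where "\<psi> k t = (\<Sum>j\<in>J. c j * H k (t - s j))" for k t
  have sm\<psi>: "smooth (\<psi> k)" for k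
    unfolding \<psi>_def[abs_def] by (rule smooth_sum_translates[OF sm])
  have cont\<psi>: "continuous_on S (\<psi> k)" for S k by (rule smooth_continuous_on[OF sm\<psi>])
  have derH: "((\<lambda>t. H (Suc k) (t - r)) has_real_derivative H k (t - r)) (at t)" for k r t
  proof -
    have "((\<lambda>t. t - r) has_real_derivative 1) (at t)" by (auto intro!: derivative_eq_intros)
    from DERIV_chain2[OF der this] show ?thesis by simp
  qed
  have "(\<psi> (Suc k) has_real_derivative \<psi> k t) (at t)" for k t
    unfolding \<psi>_def[abs_def] by (intro DERIV_sum DERIV_cmult derH)
  then have "deriv (\<psi> (Suc k)) = \<psi> k" for k
    by (intro ext DERIV_imp_deriv)
  then have iter: "(deriv ^^ k) (\<psi> k) = \<psi> 0" for k
    by (induction k) (simp_all add: funpow_swap1)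
  have \<psi>_left: "\<psi> k t = 0" if "t < a" for k t
    unfolding \<psi>_def using that s by (intro sum.neutral) (force intro: left)
  have \<psi>_right: "\<psi> p t = 0" if "b < t" for t
  proof -
    obtain q where q: "degree q \<le> m" "\<forall>t\<ge>\<epsilon>. H p t = poly q t" using right m by metis
    have "\<psi> p t = (\<Sum>j\<in>J. c j * poly (q \<circ>\<^sub>p [:t, -1:]) (s j))"
      unfolding \<psi>_def using that s q(2) by (intro sum.cong) (force simp: poly_pcompose)+
    also have "\<dots> = 0"
      by (rule annih) (use q(1) m in \<open>simp add: degree_pcompose\<close>)
    finally show ?thesis .
  qed
  have \<psi>_bound: "\<bar>\<psi> p t\<bar> \<le> (\<Sum>j\<in>J. \<bar>c j\<bar>) * (b - a) ^ m" if "t \<in> {a..b}" for t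
  proof -
    have "\<bar>\<psi> p t\<bar> \<le> (\<Sum>j\<in>J. \<bar>c j * H p (t - s j)\<bar>)"
      unfolding \<psi>_def by (rule sum_abs)
    also have "\<dots> \<le> (\<Sum>j\<in>J. \<bar>c j\<bar> * (b - a) ^ m)"
    proof (rule sum_mono)
      fix j assume j: "j \<in> J"
      have "H p (t - s j) \<le> (b - a) ^ m"
        unfolding m using s(1)[OF j] that by (intro bound) auto
      then show "\<bar>c j * H p (t - s j)\<bar> \<le> \<bar>c j\<bar> * (b - a) ^ m"
        using nonneg by (simp add: abs_mult mult_left_mono)
    qed
    finally show ?thesis by (simp add: sum_distrib_right)
  qed
  have test: "test_function A B (\<psi> p)"
    unfolding test_function_def
  proof (intro conjI exI[of _ "{a..b}"])
    show "\<forall>k t. (deriv ^^ k) (\<psi> p) differentiable (at t)" using sm\<psi> by (simp add: smooth_def)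
    show "\<forall>t. t \<notin> {a..b} \<longrightarrow> \<psi> p t = 0"
      using \<psi>_left \<psi>_right by (metis atLeastAtMost_iff not_le)
  qed (use ab in auto)
  define C where "C = (\<Sum>j\<in>J. \<bar>c j\<bar>)"
  have wab: "w absolutely_integrable_on {a..b}"
    using w ab by (intro absolutely_integrable_on_subinterval[OF w]) auto
  have rhs: "\<bar>integral {A<..<B} (\<lambda>t. w t * \<psi> p t)\<bar> \<le> C * (b - a) ^ m * integral {a..b} (\<lambda>t. \<bar>w t\<bar>)"
  proof -
    have "(\<lambda>t. \<psi> p t * w t) absolutely_integrable_on {a..b}"
    proof (rule absolutely_integrable_bounded_measurable_product_real[OF _ _ _ wab])
      show "\<psi> p \<in> borel_measurable (lebesgue_on {a..b})"
        by (intro continuous_imp_measurable_on_sets_lebesgue cont\<psi>) auto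
      show "bounded (\<psi> p ` {a..b})"
        by (intro compact_imp_bounded compact_continuous_image cont\<psi>) auto
    qed auto
    then have int: "(\<lambda>t. w t * \<psi> p t) integrable_on {a..b}"
      by (simp add: mult.commute set_lebesgue_integral_eq_integral(1))
    have "integral {A<..<B} (\<lambda>t. w t * \<psi> p t) = integral {a..b} (\<lambda>t. w t * \<psi> p t)"
      by (intro integral_unique has_integral_vanishing_outside int)
         (use ab \<psi>_left \<psi>_right in auto)
    moreover have "norm (integral {a..b} (\<lambda>t. w t * \<psi> p t))
        \<le> integral {a..b} (\<lambda>t. C * (b - a) ^ m * \<bar>w t\<bar>)"
    proof (rule integral_norm_bound_integral[OF int])
      show "(\<lambda>t. C * (b - a) ^ m * \<bar>w t\<bar>) integrable_on {a..b}"
        using wab by (intro integrable_on_mult_right) (simp add: absolutely_integrable_on_def)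
      show "norm (w t * \<psi> p t) \<le> C * (b - a) ^ m * \<bar>w t\<bar>" if "t \<in> {a..b}" for t
        using mult_left_mono[OF \<psi>_bound[OF that], of "\<bar>w t\<bar>"] by (simp add: C_def abs_mult mult_ac)
    qed
    ultimately show ?thesis by simp
  qed
  define I where "I j = integral {s j - \<epsilon>..s j + \<epsilon>} (\<lambda>t. g t * H 0 (t - s j))" for j
  have contH: "continuous_on S (\<lambda>t. H 0 (t - r))" for S r
    by (rule continuous_on_compose2[OF smooth_continuous_on[OF sm, of UNIV]])
       (auto intro!: continuous_intros)
  have gint: "(\<lambda>t. g t * H 0 (t - s j)) integrable_on {s j - \<epsilon>..s j + \<epsilon>}" if "j \<in> J" for j
    using s[OF that] ab
    by (intro integrable_continuous_real continuous_on_mult contH continuous_on_subset[OF g]) auto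
  have lhs: "integral {A<..<B} (\<lambda>t. g t * (deriv ^^ p) (\<psi> p) t) = (\<Sum>j\<in>J. c j * I j)"
  proof (rule integral_unique)
    have "((\<lambda>t. g t * H 0 (t - s j)) has_integral I j) {A<..<B}" if "j \<in> J" for j
      unfolding I_def
      by (intro has_integral_vanishing_outside gint) (use s[OF that] ab that in \<open>auto simp: left right0\<close>)
    then have "((\<lambda>t. \<Sum>j\<in>J. c j * (g t * H 0 (t - s j))) has_integral (\<Sum>j\<in>J. c j * I j)) {A<..<B}"
      by (intro has_integral_sum[OF fin] has_integral_mult_right) auto
    then show "((\<lambda>t. g t * (deriv ^^ p) (\<psi> p) t) has_integral (\<Sum>j\<in>J. c j * I j)) {A<..<B}"
      by (simp add: iter \<psi>_def sum_distrib_left mult_ac)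
  qed
  have I_close: "\<bar>I j - v j\<bar> \<le> e" if j: "j \<in> J" for j
  proof -
    have unit: "((\<lambda>t. H 0 (t - s j)) has_integral 1) {s j - \<epsilon>..s j + \<epsilon>}"
    proof -
      have "((\<lambda>t. H 0 (t - s j)) has_integral
          H (Suc 0) (s j + \<epsilon> - s j) - H (Suc 0) (s j - \<epsilon> - s j)) {s j - \<epsilon>..s j + \<epsilon>}"
        by (rule fundamental_theorem_of_calculus)
           (use eps derH in \<open>auto simp: has_real_derivative_iff_has_vector_derivative[symmetric]
              intro: has_field_derivative_at_within\<close>)
      then show ?thesis by (simp add: mass left)
    qed
    have d: "((\<lambda>t. g t * H 0 (t - s j) - v j * H 0 (t - s j)) has_integral I j - v j * 1)
        {s j - \<epsilon>..s j + \<epsilon>}"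
      unfolding I_def
      by (intro has_integral_diff has_integral_mult_right unit integrable_integral gint j)
    have "norm (I j - v j * 1) \<le> integral {s j - \<epsilon>..s j + \<epsilon>} (\<lambda>t. e * H 0 (t - s j))"
      unfolding integral_unique[OF d, symmetric]
    proof (rule integral_norm_bound_integral)
      show "(\<lambda>t. g t * H 0 (t - s j) - v j * H 0 (t - s j)) integrable_on {s j - \<epsilon>..s j + \<epsilon>}"
        using d by blast
      show "(\<lambda>t. e * H 0 (t - s j)) integrable_on {s j - \<epsilon>..s j + \<epsilon>}"
        using unit by (intro integrable_on_mult_right) blast
      show "norm (g t * H 0 (t - s j) - v j * H 0 (t - s j)) \<le> e * H 0 (t - s j)"
        if "t \<in> {s j - \<epsilon>..s j + \<epsilon>}" for t
      proof -
        have "\<bar>g t - v j\<bar> \<le> e" using that by (intro close j) auto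
        then have "\<bar>g t - v j\<bar> * H 0 (t - s j) \<le> e * H 0 (t - s j)"
          by (intro mult_right_mono nonneg)
        then show ?thesis
          using nonneg[of 0 "t - s j"] by (simp add: abs_mult flip: left_diff_distrib)
      qed
    qed
    also have "\<dots> = e"
      using integral_unique[OF has_integral_mult_right[OF unit, of e]] by (simp only: mult_1_right)
    finally show ?thesis by simp
  qed
  have "(\<Sum>j\<in>J. c j * v j) = (\<Sum>j\<in>J. c j * I j) - (\<Sum>j\<in>J. c j * (I j - v j))"
    by (simp add: right_diff_distrib sum_subtractf)
  also have "\<bar>\<dots>\<bar> \<le> \<bar>\<Sum>j\<in>J. c j * I j\<bar> + \<bar>\<Sum>j\<in>J. c j * (I j - v j)\<bar>"
    by (rule abs_triangle_ineq4)
  also have "\<bar>\<Sum>j\<in>J. c j * I j\<bar> \<le> C * (b - a) ^ m * integral {a..b} (\<lambda>t. \<bar>w t\<bar>)"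
    using weak test rhs unfolding has_weak_deriv_def lhs[symmetric]
    by (auto simp: abs_mult power_abs)
  also have "\<bar>\<Sum>j\<in>J. c j * (I j - v j)\<bar> \<le> C * e"
    unfolding C_def sum_distrib_right using I_close
    by (intro order_trans[OF sum_abs] sum_mono) (auto simp: abs_mult intro: mult_left_mono)
  finally show ?thesis by (simp add: C_def m algebra_simps)
qed

text \<open>Nodes may be end points of \<open>[a, b]\<close>, and \<open>[a, b]\<close> may reach the boundary of \<open>[A, B]\<close>, where no test
  function lives. Contracting the nodes towards the midpoint leaves room for a mollifier inside
  \<open>(a, b)\<close> and preserves annihilation, since polynomials are stable under affine substitution. By
  uniform continuity of \<open>g\<close> the values change by an arbitrarily small amount.\<close>

lemma weak_derivative_functional_bound:
  fixes g w :: "real \<Rightarrow> real"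
  assumes p: "1 \<le> p" and weak: "has_weak_deriv p A B g w"
    and w: "w absolutely_integrable_on {A<..<B}" and g: "continuous_on {A..B} g"
    and ab: "A \<le> a" "a < b" "b \<le> B" and fin: "finite J"
    and s: "\<And>j. j \<in> J \<Longrightarrow> s j \<in> {a..b}"
    and annih: "\<And>q. degree q < p \<Longrightarrow> (\<Sum>j\<in>J. c j * poly q (s j)) = 0"
  shows "\<bar>\<Sum>j\<in>J. c j * g (s j)\<bar>
      \<le> (\<Sum>j\<in>J. \<bar>c j\<bar>) * ((b - a) ^ (p - 1) * integral {a..b} (\<lambda>t. \<bar>w t\<bar>))"
proof -
  define C where "C = (\<Sum>j\<in>J. \<bar>c j\<bar>)"
  define W where "W = (b - a) ^ (p - 1) * integral {a..b} (\<lambda>t. \<bar>w t\<bar>)"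
  have C0: "0 \<le> C" by (simp add: C_def sum_nonneg)
  have wabs: "(\<lambda>t. \<bar>w t\<bar>) integrable_on {A..B}"
    using w by (simp add: absolutely_integrable_on_def integrable_on_Icc_iff_Ioo)
  have "\<bar>\<Sum>j\<in>J. c j * g (s j)\<bar> \<le> C * (W + e)" if e: "e > 0" for e
  proof -
    have "uniformly_continuous_on {a..b} g"
      using ab by (intro compact_uniformly_continuous continuous_on_subset[OF g]) auto
    then obtain d where d: "d > 0"
      "\<And>t r. t \<in> {a..b} \<Longrightarrow> r \<in> {a..b} \<Longrightarrow> \<bar>r - t\<bar> < d \<Longrightarrow> \<bar>g r - g t\<bar> < e"
      using e unfolding uniformly_continuous_on_def dist_real_def by metis
    \<comment> \<open>The contraction by \<open>1 - \<delta>\<close> moves a node by at most \<open>2 \<epsilon>\<close> and leaves a distance of at least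
      \<open>2 \<epsilon>\<close> to both end points; \<open>\<delta>\<close> is so small that \<open>3 \<epsilon> < d\<close>.\<close>
    define \<delta> where "\<delta> = min (1 / 2) (d / (2 * (b - a)))"
    have \<delta>: "0 < \<delta>" "\<delta> \<le> 1 / 2" "\<delta> * (b - a) \<le> d / 2"
      using d(1) ab by (auto simp: \<delta>_def min_def field_simps)
    define \<epsilon> where "\<epsilon> = \<delta> * (b - a) / 4"
    have eps: "\<epsilon> > 0" using \<delta> ab by (simp add: \<epsilon>_def)
    define s' where "s' j = (a + b) / 2 + (1 - \<delta>) * (s j - (a + b) / 2)" for j
    have s'_eq: "s' j = s j - \<delta> * (s j - (a + b) / 2)" for j
    proof -
      have "m + (1 - \<delta>) * (r - m) = r - \<delta> * (r - m)" for m r by (simp add: algebra_simps)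
      then show ?thesis unfolding s'_def .
    qed
    have s': "a + 2 * \<epsilon> \<le> s' j" "s' j \<le> b - 2 * \<epsilon>" "\<bar>s' j - s j\<bar> \<le> 2 * \<epsilon>" if "j \<in> J" for j
    proof -
      have r: "\<bar>s j - (a + b) / 2\<bar> \<le> (b - a) / 2" using s[OF that] by (auto simp: abs_le_iff field_simps)
      have "(1 - \<delta>) * \<bar>s j - (a + b) / 2\<bar> \<le> (1 - \<delta>) * ((b - a) / 2)"
        using r \<delta> by (intro mult_left_mono) auto
      then have "\<bar>(1 - \<delta>) * (s j - (a + b) / 2)\<bar> \<le> (1 - \<delta>) * ((b - a) / 2)"
        using \<delta> by (simp add: abs_mult)
      also have "(1 - \<delta>) * ((b - a) / 2) = (b - a) / 2 - 2 * \<epsilon>"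
        by (simp add: \<epsilon>_def field_simps)
      finally have "\<bar>(1 - \<delta>) * (s j - (a + b) / 2)\<bar> \<le> (b - a) / 2 - 2 * \<epsilon>" .
      then show "a + 2 * \<epsilon> \<le> s' j" "s' j \<le> b - 2 * \<epsilon>"
        unfolding s'_def by argo+
      have "\<delta> * \<bar>s j - (a + b) / 2\<bar> \<le> \<delta> * ((b - a) / 2)"
        using r \<delta> by (intro mult_left_mono) auto
      then show "\<bar>s' j - s j\<bar> \<le> 2 * \<epsilon>"
        unfolding s'_eq \<epsilon>_def using \<delta> by (simp add: abs_mult)
    qed
    have e4: "4 * \<epsilon> \<le> (b - a) / 2" "4 * \<epsilon> < d"
      using \<delta> d(1) ab mult_right_mono[OF \<delta>(2), of "b - a"] by (auto simp: \<epsilon>_def)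
    have "\<bar>\<Sum>j\<in>J. c j * g (s j)\<bar> \<le> C * ((b - \<epsilon> - (a + \<epsilon>)) ^ (p - 1) *
        integral {a + \<epsilon>..b - \<epsilon>} (\<lambda>t. \<bar>w t\<bar>) + e)"
      unfolding C_def
    proof (rule mollified_functional_bound[OF p weak w g _ _ _ eps fin, where s = s'])
      fix q :: "real poly" assume q: "degree q < p"
      define l where "l = [:(a + b) / 2 * \<delta>, 1 - \<delta>:]"
      have "m * \<delta> + r * (1 - \<delta>) = m + (1 - \<delta>) * (r - m)" for m r
        by (simp add: algebra_simps)
      then have "poly l (s j) = s' j" for j
        unfolding l_def s'_def by (simp only: poly_pCons poly_0 mult_zero_right add_0_right)
      then have "(\<Sum>j\<in>J. c j * poly q (s' j)) = (\<Sum>j\<in>J. c j * poly (q \<circ>\<^sub>p l) (s j))"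
        by (simp add: poly_pcompose)
      also have "\<dots> = 0"
        by (rule annih) (use q \<delta> in \<open>simp add: l_def degree_pcompose\<close>)
      finally show "(\<Sum>j\<in>J. c j * poly q (s' j)) = 0" .
    next
      fix j t assume j: "j \<in> J" and t: "\<bar>t - s' j\<bar> \<le> \<epsilon>"
      have "\<bar>g t - g (s j)\<bar> < e"
        using s'[OF j] t e4 eps s[OF j] by (intro d(2)) (auto simp: abs_le_iff abs_less_iff)
      then show "\<bar>g t - g (s j)\<bar> \<le> e" by simp
    qed (use s' eps e4 ab in \<open>force+\<close>)
    also have "\<dots> \<le> C * (W + e)"
    proof -
      have "integral {a + \<epsilon>..b - \<epsilon>} (\<lambda>t. \<bar>w t\<bar>) \<le> integral {a..b} (\<lambda>t. \<bar>w t\<bar>)"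
        using eps ab by (intro integral_subset_le integrable_on_subinterval[OF wabs]) auto
      moreover have "(b - \<epsilon> - (a + \<epsilon>)) ^ (p - 1) \<le> (b - a) ^ (p - 1)"
        using eps e4 ab by (intro power_mono) auto
      ultimately have "(b - \<epsilon> - (a + \<epsilon>)) ^ (p - 1) * integral {a + \<epsilon>..b - \<epsilon>} (\<lambda>t. \<bar>w t\<bar>) \<le> W"
        unfolding W_def
        using eps ab by (intro mult_mono integral_nonneg integrable_on_subinterval[OF wabs]) auto
      then show ?thesis using C0 by (intro mult_left_mono) auto
    qed
    finally show ?thesis .
  qed
  then have "\<bar>\<Sum>j\<in>J. c j * g (s j)\<bar> \<le> C * W + e" if "e > 0" for e
  proof (cases "C = 0")
    case True
    then show ?thesis using \<open>\<And>e. e > 0 \<Longrightarrow> _ \<le> C * (W + e)\<close>[OF that] that by simp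
  next
    case False
    then show ?thesis
      using \<open>\<And>e. e > 0 \<Longrightarrow> _ \<le> C * (W + e)\<close>[of "e / C"] that C0 by (simp add: distrib_left)
  qed
  then have "\<bar>\<Sum>j\<in>J. c j * g (s j)\<bar> \<le> C * W" by (rule field_le_epsilon)
  then show ?thesis by (simp add: C_def W_def)
qed

section \<open>Consistency of the Adams--Bashforth weights\<close>

lemma prod_differences_consecutive:
  assumes "k < M"
  shows "(\<Prod>i\<in>{..<M} - {k}. real i - real k) = (- 1) ^ k * fact k * fact (M - 1 - k)"
proof -
  have split: "{..<M} - {k} = {..<k} \<union> {k<..<M}" using assms by auto
  have "(\<Prod>i<k. real i - real k) = (\<Prod>i<k. - 1 * (real k - real i))"
    by simp
  also have "\<dots> = (- 1) ^ k * (\<Prod>i<k. real (k - i))"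
    unfolding prod.distrib by (simp add: of_nat_diff)
  also have "(\<Prod>i<k. real (k - i)) = fact k"
  proof -
    have "(\<Prod>i<k. real (k - i)) = (\<Prod>i\<in>{1..k}. real i)"
      by (rule prod.reindex_bij_witness[of _ "\<lambda>i. k - i" "\<lambda>i. k - i"]) auto
    then show ?thesis by (simp add: fact_prod)
  qed
  finally have low: "(\<Prod>i<k. real i - real k) = (- 1) ^ k * fact k" .
  have "(\<Prod>i\<in>{k<..<M}. real i - real k) = (\<Prod>i\<in>{1..M - 1 - k}. real i)"
    by (rule prod.reindex_bij_witness[of _ "\<lambda>i. i + k" "\<lambda>i. i - k"]) (auto simp: of_nat_diff)
  then have high: "(\<Prod>i\<in>{k<..<M}. real i - real k) = fact (M - 1 - k)"
    by (simp add: fact_prod)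
  show ?thesis
    unfolding split by (subst prod.union_disjoint) (auto simp: low high)
qed

text \<open>The factorials and the sign in the definition of the weights are the denominator of the
  Lagrange basis function for the node \<open>-k\<close>.\<close>

lemma AB_beta_eq_integral_lagrange_basis:
  assumes "k < M"
  shows "((\<lambda>u. lagrange_basis {..<M} (\<lambda>i. - real i) k u) has_integral AB_beta M (Suc k)) {0..1}"
proof -
  have set_eq: "{0..M - 1} = {..<M}" using assms by auto
  define P where "P u = (\<Prod>i\<in>{..<M} - {k}. u + real i)" for u
  define D where "D = (\<Prod>i\<in>{..<M} - {k}. real i - real k)"
  have D: "D = (- 1) ^ k * fact k * fact (M - 1 - k)"
    unfolding D_def by (rule prod_differences_consecutive[OF assms])
  have "P integrable_on {0..1}"
    unfolding P_def[abs_def] by (intro integrable_continuous_real continuous_intros)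
  then have "((\<lambda>u. P u * inverse D) has_integral integral {0..1} P * inverse D) {0..1}"
    by (intro has_integral_mult_left integrable_integral)
  moreover have "lagrange_basis {..<M} (\<lambda>i. - real i) k u = P u * inverse D" for u
    unfolding lagrange_basis_def P_def D_def diff_minus_eq_add uminus_add_conv_diff prod_dividef
    by (rule divide_inverse)
  moreover have "AB_beta M (Suc k) = integral {0..1} P * inverse D"
    unfolding AB_beta_def P_def D set_eq diff_Suc_1 using assms
    by (simp add: divide_inverse set_eq power_inverse[symmetric] ac_simps Suc_le_eq)
  ultimately show ?thesis by simp
qed

text \<open>After the substitution \<open>t = \<tau> + u h\<close> this is the fundamental theorem of calculus for a polynomial
  whose derivative is reproduced by interpolation at \<open>0, -1, ..., -(M-1)\<close>.\<close>

lemma AB_exact_on_polynomials: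
  fixes P :: "real poly"
  assumes "degree P \<le> M" "1 \<le> M"
  shows "poly P (\<tau> + h) - poly P \<tau>
      = h * (\<Sum>k<M. AB_beta M (Suc k) * poly (pderiv P) (\<tau> - real k * h))"
proof -
  define Q where "Q = P \<circ>\<^sub>p [:\<tau>, h:]"
  have dQ: "degree (pderiv Q) < M"
  proof -
    have "degree Q \<le> M"
      unfolding Q_def using assms degree_pCons_le[of \<tau> "[:h:]"]
      by (intro order_trans[OF degree_pcompose_le])
         (metis One_nat_def degree_pCons_0 mult.right_neutral mult_le_mono)
    then show ?thesis using assms by (auto simp: degree_pderiv)
  qed
  have inj: "inj_on (\<lambda>i. - real i) {..<M}" by (auto simp: inj_on_def)
  have pQ: "poly (pderiv Q) u = h * poly (pderiv P) (\<tau> + u * h)" for u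
    by (simp add: Q_def pderiv_pcompose poly_pcompose pderiv_pCons)
  have "(poly (pderiv Q) has_integral poly Q 1 - poly Q 0) {0..1}"
    by (rule fundamental_theorem_of_calculus)
       (use poly_DERIV[of Q] in \<open>auto simp: has_real_derivative_iff_has_vector_derivative[symmetric]
          intro: has_field_derivative_at_within\<close>)
  moreover have "(poly (pderiv Q) has_integral
      (\<Sum>k<M. poly (pderiv Q) (- real k) * AB_beta M (Suc k))) {0..1}"
  proof (rule has_integral_eq)
    show "((\<lambda>u. \<Sum>k<M. poly (pderiv Q) (- real k) * lagrange_basis {..<M} (\<lambda>i. - real i) k u)
        has_integral (\<Sum>k<M. poly (pderiv Q) (- real k) * AB_beta M (Suc k))) {0..1}"
      by (intro has_integral_sum has_integral_mult_right AB_beta_eq_integral_lagrange_basis) auto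
    show "(\<Sum>k<M. poly (pderiv Q) (- real k) * lagrange_basis {..<M} (\<lambda>i. - real i) k u)
        = poly (pderiv Q) u" for u
      using lagrange_interpolation_exact[OF _ inj, of "pderiv Q" u] dQ by simp
  qed
  ultimately have "poly Q 1 - poly Q 0 = (\<Sum>k<M. poly (pderiv Q) (- real k) * AB_beta M (Suc k))"
    by (rule has_integral_unique)
  then show ?thesis
    by (simp add: Q_def[symmetric] pQ sum_distrib_left mult_ac)
       (simp add: Q_def poly_pcompose algebra_simps)
qed

text \<open>The weight is a positive multiple of the integral of a product of factors \<open>u + i\<close> with \<open>i \<ge> 1\<close>. As the
  leading coefficient of the discovery polynomial it fixes the degree of that polynomial.\<close>

lemma AB_beta_1_pos:
  assumes "1 \<le> M"
  shows "AB_beta M 1 > 0"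
proof -
  define P where "P u = (\<Prod>i\<in>{0..M - 1} - {0}. u + real i)" for u
  have cont: "continuous_on {0..1} P" unfolding P_def[abs_def] by (intro continuous_intros)
  have nn: "P u \<ge> 0" if "u \<ge> 0" for u unfolding P_def using that by (intro prod_nonneg) auto
  have "integral {0..1} P \<noteq> 0"
  proof
    assume 0: "integral {0..1} P = 0"
    have "(P has_integral 0) (cbox 0 1)"
      using integrable_integral[OF integrable_continuous_real[OF cont]] 0 by simp
    then have "P 1 = 0"
      using has_integral_0_cbox_imp_0[of 0 1 P 1] cont nn by auto
    moreover have "P 1 > 0" unfolding P_def by (intro prod_pos) auto
    ultimately show False by simp
  qed
  moreover have "integral {0..1} P \<ge> 0"
    by (intro integral_nonneg integrable_continuous_real cont nn) auto
  ultimately have "integral {0..1} P > 0" by linarith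
  then have "integral {0..1} P / fact (M - 1) > 0" by simp
  moreover have "AB_beta M 1 = integral {0..1} P / fact (M - 1)"
    unfolding AB_beta_def P_def using assms by simp
  ultimately show ?thesis by simp
qed

lemma taylor_remainder_within:
  fixes D :: "nat \<Rightarrow> real \<Rightarrow> real"
  assumes der: "\<And>j t. j < p \<Longrightarrow> t \<in> {a..b} \<Longrightarrow> (D j has_real_derivative D (Suc j) t) (at t within {a..b})"
    and bnd: "\<And>t. t \<in> {a..b} \<Longrightarrow> \<bar>D p t\<bar> \<le> B" and "a \<le> b" "0 < p" "0 \<le> B"
  shows "\<bar>D 0 b - (\<Sum>i<p. (b - a) ^ i / fact i * D i a)\<bar> \<le> B * (b - a) ^ p"
proof -
  let ?i = "\<lambda>x. ((b - x) ^ (p - 1) / fact (p - 1)) *\<^sub>R D p x"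
  have "(?i has_integral D 0 b - (\<Sum>i<p. ((b - a) ^ i / fact i) *\<^sub>R D i a)) {a..b}"
    by (rule Taylor_has_integral[OF \<open>0 < p\<close> refl _ \<open>a \<le> b\<close>])
       (use der in \<open>auto simp: has_real_derivative_iff_has_vector_derivative\<close>)
  then have "norm (D 0 b - (\<Sum>i<p. ((b - a) ^ i / fact i) *\<^sub>R D i a))
      \<le> (B * (b - a) ^ (p - 1)) * Henstock_Kurzweil_Integration.content (cbox a b)"
  proof (intro has_integral_bound[where f = ?i])
    show "norm (?i t) \<le> B * (b - a) ^ (p - 1)" if "t \<in> cbox a b" for t
    proof -
      have "(b - t) ^ (p - 1) / fact (p - 1) \<le> (b - t) ^ (p - 1) / 1"
        using that by (intro divide_left_mono) (auto simp: fact_ge_1)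
      also have "\<dots> \<le> (b - a) ^ (p - 1)" using that by (simp add: power_mono)
      finally have "(b - t) ^ (p - 1) / fact (p - 1) \<le> (b - a) ^ (p - 1)" .
      then have "\<bar>D p t\<bar> * ((b - t) ^ (p - 1) / fact (p - 1)) \<le> B * (b - a) ^ (p - 1)"
        using that bnd[of t] \<open>0 \<le> B\<close> by (intro mult_mono) auto
      then show ?thesis using that by (simp add: abs_mult mult.commute)
    qed
  qed (use \<open>a \<le> b\<close> \<open>0 \<le> B\<close> in auto)
  also have "\<dots> = B * (b - a) ^ p"
    using \<open>a \<le> b\<close> \<open>0 < p\<close> by (simp add: power_eq_if[of _ p])
  finally show ?thesis by simp
qed

text \<open>Both \<open>D 0\<close> and \<open>D 1\<close> are compared with the Taylor polynomial of \<open>D 0\<close> at the left end of the stencil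
  and its derivative. The scheme is exact on the polynomial, so only the remainders contribute.\<close>

lemma AB_truncation_error:
  fixes D :: "nat \<Rightarrow> real \<Rightarrow> real"
  assumes M: "1 \<le> M"
    and der: "\<And>j t. j \<le> M \<Longrightarrow> t \<in> {a..b} \<Longrightarrow> (D j has_real_derivative D (Suc j) t) (at t within {a..b})"
    and bnd: "\<And>t. t \<in> {a..b} \<Longrightarrow> \<bar>D (Suc M) t\<bar> \<le> B" and B: "0 \<le> B"
    and h: "0 < h" and b: "b = a + real M * h"
  shows "\<bar>(\<Sum>k<M. AB_beta M (Suc k) * D 1 (b - real (Suc k) * h)) - (D 0 b - D 0 (b - h)) / h\<bar>
      \<le> B * (2 * real M ^ (M + 1) + real M ^ M * (\<Sum>k<M. \<bar>AB_beta M (Suc k)\<bar>)) * h ^ M"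
proof -
  define P where "P = (\<Sum>i<Suc M. monom (D i a / fact i) i) \<circ>\<^sub>p [:-a, 1:]"
  have P: "poly P t = (\<Sum>i<Suc M. (t - a) ^ i / fact i * D i a)" for t
    unfolding P_def poly_pcompose poly_sum by (intro sum.cong) (auto simp: poly_monom)
  have P': "poly (pderiv P) t = (\<Sum>i<M. (t - a) ^ i / fact i * D (Suc i) a)" for t
  proof -
    have "(poly P has_real_derivative (\<Sum>i<Suc M. real i * (t - a) ^ (i - 1) / fact i * D i a)) (at t)"
      unfolding P by (auto intro!: derivative_eq_intros sum.cong)
    then have "poly (pderiv P) t = (\<Sum>i<Suc M. real i * (t - a) ^ (i - 1) / fact i * D i a)"
      by (rule DERIV_unique[OF poly_DERIV])
    also have "\<dots> = (\<Sum>i<M. real (Suc i) * (t - a) ^ i / fact (Suc i) * D (Suc i) a)"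
      by (subst sum.lessThan_Suc_shift) simp
    also have "\<dots> = (\<Sum>i<M. (t - a) ^ i / fact i * D (Suc i) a)"
      by (intro sum.cong) (auto simp: field_simps simp del: of_nat_Suc)
    finally show ?thesis .
  qed
  have degP: "degree P \<le> M"
  proof -
    have "degree (\<Sum>i<Suc M. monom (D i a / fact i) i) \<le> M"
      by (rule degree_sum_le) (auto intro: order_trans[OF degree_monom_le])
    then show ?thesis
      unfolding P_def by (intro order_trans[OF degree_pcompose_le]) simp
  qed
  have der': "(D j has_real_derivative D (Suc j) t) (at t within {a..c})"
    if "j \<le> M" "t \<in> {a..c}" "c \<le> b" for j t c
    by (rule DERIV_subset[OF der]) (use that in auto)
  have R: "\<bar>D 0 t - poly P t\<bar> \<le> B * (real M * h) ^ (M + 1)" if "t \<in> {a..b}" for t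
  proof -
    have "\<bar>D 0 t - poly P t\<bar> \<le> B * (t - a) ^ Suc M"
      unfolding P by (rule taylor_remainder_within) (use that der' bnd B in auto)
    also have "\<dots> \<le> B * (real M * h) ^ Suc M"
      using that b B by (intro mult_left_mono power_mono) auto
    finally show ?thesis by simp
  qed
  have R': "\<bar>D 1 t - poly (pderiv P) t\<bar> \<le> B * (real M * h) ^ M" if "t \<in> {a..b}" for t
  proof -
    have "\<bar>D (Suc 0) t - poly (pderiv P) t\<bar> \<le> B * (t - a) ^ M"
      unfolding P' by (rule taylor_remainder_within[where D = "\<lambda>j. D (Suc j)"])
        (use that der' bnd B M in auto)
    also have "\<dots> \<le> B * (real M * h) ^ M"
      using that b B by (intro mult_left_mono power_mono) auto
    finally show ?thesis by simp
  qed
  have nodes: "b - real (Suc k) * h \<in> {a..b}" if "k < M" for k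
  proof -
    have "real (Suc k) * h \<le> real M * h" using that h by (intro mult_right_mono) auto
    moreover have "0 \<le> real (Suc k) * h" using h by (intro mult_nonneg_nonneg) auto
    ultimately show ?thesis using b by auto
  qed
  have bh: "b - h \<in> {a..b}" using nodes[of 0] M by simp
  have ab: "b \<in> {a..b}" using b h by simp
  have exact: "(\<Sum>k<M. AB_beta M (Suc k) * poly (pderiv P) (b - real (Suc k) * h))
      = (poly P b - poly P (b - h)) / h"
    using AB_exact_on_polynomials[OF degP M, of "b - h" h] h
    by (simp add: field_simps)
  have "(\<Sum>k<M. AB_beta M (Suc k) * D 1 (b - real (Suc k) * h)) - (D 0 b - D 0 (b - h)) / h
      = (\<Sum>k<M. AB_beta M (Suc k) * (D 1 (b - real (Suc k) * h) - poly (pderiv P) (b - real (Suc k) * h)))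
        - ((D 0 b - poly P b) - (D 0 (b - h) - poly P (b - h))) / h"
    unfolding right_diff_distrib sum_subtractf exact by (simp add: diff_divide_distrib)
  also have "\<bar>\<dots>\<bar> \<le> (\<Sum>k<M. \<bar>AB_beta M (Suc k)\<bar>) * (B * (real M * h) ^ M)
      + (2 * (B * (real M * h) ^ (M + 1))) / h"
  proof (rule order_trans[OF abs_triangle_ineq4] add_mono)+
    show "\<bar>\<Sum>k<M. AB_beta M (Suc k) * (D 1 (b - real (Suc k) * h) - poly (pderiv P) (b - real (Suc k) * h))\<bar>
        \<le> (\<Sum>k<M. \<bar>AB_beta M (Suc k)\<bar>) * (B * (real M * h) ^ M)"
      unfolding sum_distrib_right
      by (rule order_trans[OF sum_abs] sum_mono)+
         (auto simp: abs_mult intro!: mult_left_mono R' nodes simp del: of_nat_Suc One_nat_def)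
    show "\<bar>((D 0 b - poly P b) - (D 0 (b - h) - poly P (b - h))) / h\<bar>
        \<le> 2 * (B * (real M * h) ^ (M + 1)) / h"
    proof -
      have "\<bar>(D 0 b - poly P b) - (D 0 (b - h) - poly P (b - h))\<bar> \<le> 2 * (B * (real M * h) ^ (M + 1))"
        using abs_triangle_ineq4[of "D 0 b - poly P b" "D 0 (b - h) - poly P (b - h)"]
          R[OF ab] R[OF bh] by linarith
      then show ?thesis
        unfolding abs_divide abs_of_pos[OF h] by (rule divide_right_mono) (use h in auto)
    qed
  qed
  also have "\<dots> = B * (2 * real M ^ (M + 1) + real M ^ M * (\<Sum>k<M. \<bar>AB_beta M (Suc k)\<bar>)) * h ^ M"
    using h by (simp add: power_mult_distrib field_simps)
  finally show ?thesis .
qed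

section \<open>Recovering the integral from grid values\<close>

text \<open>The functional \<open>g(\<theta>) - \<Sum>\<^sub>j \<l>\<^sub>j(\<theta>) g(a + j h)\<close> annihilates polynomials of degree less than \<open>p\<close>. Each
  factor of \<open>\<l>\<^sub>j(\<theta>)\<close> has numerator at most \<open>p h\<close> and denominator at least \<open>h\<close>, so the coefficients
  are bounded independently of \<open>h\<close>.\<close>

lemma window_pointwise_bound:
  fixes g w :: "real \<Rightarrow> real"
  assumes p: "1 \<le> p" and weak: "has_weak_deriv p A B g w"
    and w: "w absolutely_integrable_on {A<..<B}" and g: "continuous_on {A..B} g"
    and h: "0 < h" and a: "A \<le> a" "a + real p * h \<le> B"
    and \<theta>: "\<theta> \<in> {a..a + real p * h}"
  shows "\<bar>g \<theta>\<bar> \<le> real p ^ p * (\<Sum>j<p. \<bar>g (a + real j * h)\<bar>)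
      + (1 + real p * real p ^ p) * ((real p * h) ^ (p - 1) * integral {a..a + real p * h} (\<lambda>t. \<bar>w t\<bar>))"
proof -
  define b where "b = a + real p * h"
  define W where "W = (real p * h) ^ (p - 1) * integral {a..b} (\<lambda>t. \<bar>w t\<bar>)"
  define node where "node j = a + real j * h" for j :: nat
  define \<l> where "\<l> j = lagrange_basis {..<p} node j \<theta>" for j
  \<comment> \<open>Index \<open>p\<close> carries the evaluation point \<open>\<theta>\<close>, the smaller indices the interpolation nodes.\<close>
  define s where "s j = (if j = p then \<theta> else node j)" for j
  define c where "c j = (if j = p then 1 else - \<l> j)" for j
  have p1: "1 \<le> real p" using p by simp
  have node_in: "node j \<in> {a..b}" if "j \<le> p" for j
    using that h by (auto simp: node_def b_def)
  have inj: "inj_on node {..<p}" using h by (auto simp: inj_on_def node_def)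
  have \<l>_bound: "\<bar>\<l> j\<bar> \<le> real p ^ p" if j: "j < p" for j
  proof -
    have "\<bar>\<l> j\<bar> = (\<Prod>i\<in>{..<p} - {j}. \<bar>\<theta> - node i\<bar> / \<bar>node j - node i\<bar>)"
      by (simp add: \<l>_def lagrange_basis_def abs_prod)
    also have "\<dots> \<le> (\<Prod>i\<in>{..<p} - {j}. real p)"
    proof (rule prod_mono)
      fix i assume i: "i \<in> {..<p} - {j}"
      have "node j - node i = (real j - real i) * h" by (simp add: node_def algebra_simps)
      moreover have "1 \<le> \<bar>real j - real i\<bar>" using i by auto
      ultimately have 1: "h \<le> \<bar>node j - node i\<bar>" using h by (simp add: abs_mult)
      have "\<bar>\<theta> - node i\<bar> \<le> real p * h"
        using \<theta> node_in[of i] i by (auto simp: b_def)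
      also have "\<dots> \<le> real p * \<bar>node j - node i\<bar>" using 1 by (intro mult_left_mono) auto
      finally have "\<bar>\<theta> - node i\<bar> / \<bar>node j - node i\<bar> \<le> real p"
        using 1 h by (intro mult_imp_div_pos_le) auto
      then show "0 \<le> \<bar>\<theta> - node i\<bar> / \<bar>node j - node i\<bar> \<and> \<bar>\<theta> - node i\<bar> / \<bar>node j - node i\<bar> \<le> real p"
        by simp
    qed
    also have "\<dots> = real p ^ (p - 1)" using j by simp
    also have "\<dots> \<le> real p ^ p" using p1 by (intro power_increasing) auto
    finally show ?thesis .
  qed
  have split: "(\<Sum>j\<in>{..<Suc p}. F (c j) (s j)) = (\<Sum>j<p. F (- \<l> j) (node j)) + F 1 \<theta>"
    for F :: "real \<Rightarrow> real \<Rightarrow> real"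
    by (simp add: c_def s_def)
  have "\<bar>\<Sum>j\<in>{..<Suc p}. c j * g (s j)\<bar>
      \<le> (\<Sum>j\<in>{..<Suc p}. \<bar>c j\<bar>) * ((b - a) ^ (p - 1) * integral {a..b} (\<lambda>t. \<bar>w t\<bar>))"
  proof (rule weak_derivative_functional_bound[OF p weak w g])
    show "a < b" using h p by (simp add: b_def)
    show "s j \<in> {a..b}" if "j \<in> {..<Suc p}" for j
      using that \<theta> node_in[of j] by (auto simp: s_def b_def)
    show "(\<Sum>j\<in>{..<Suc p}. c j * poly q (s j)) = 0" if "degree q < p" for q
      using lagrange_interpolation_exact[OF _ inj, of q \<theta>] that
      unfolding split[of "\<lambda>x y. x * poly q y"] by (simp add: \<l>_def sum_negf mult.commute)
  qed (use a in \<open>auto simp: b_def\<close>)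
  also have "(b - a) ^ (p - 1) * integral {a..b} (\<lambda>t. \<bar>w t\<bar>) = W" by (simp add: W_def b_def)
  also have "(\<Sum>j\<in>{..<Suc p}. \<bar>c j\<bar>) * W \<le> (1 + real p * real p ^ p) * W"
  proof (rule mult_right_mono)
    have "(\<Sum>j<p. \<bar>\<l> j\<bar>) \<le> real (card {..<p}) * real p ^ p"
      by (rule sum_bounded_above) (use \<l>_bound in auto)
    then show "(\<Sum>j\<in>{..<Suc p}. \<bar>c j\<bar>) \<le> 1 + real p * real p ^ p"
      unfolding split[of "\<lambda>x y. \<bar>x\<bar>"] by simp
    have "(\<lambda>t. \<bar>w t\<bar>) integrable_on {A..B}"
      using w by (simp add: absolutely_integrable_on_def integrable_on_Icc_iff_Ioo)
    then have "0 \<le> integral {a..b} (\<lambda>t. \<bar>w t\<bar>)"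
      using a by (intro integral_nonneg) (auto simp: b_def intro: integrable_on_subinterval)
    then show "0 \<le> W" using h by (simp add: W_def)
  qed
  finally have main: "\<bar>g \<theta> - (\<Sum>j<p. \<l> j * g (node j))\<bar> \<le> (1 + real p * real p ^ p) * W"
    unfolding split[of "\<lambda>x y. x * g y"] by (simp add: sum_negf)
  have "\<bar>\<Sum>j<p. \<l> j * g (node j)\<bar> \<le> (\<Sum>j<p. real p ^ p * \<bar>g (node j)\<bar>)"
    by (rule order_trans[OF sum_abs] sum_mono)+
       (auto simp: abs_mult intro!: mult_right_mono \<l>_bound)
  then show ?thesis
    using main by (simp add: W_def b_def node_def sum_distrib_left)
qed

lemma window_integral_bound:
  fixes g w :: "real \<Rightarrow> real"
  assumes p: "1 \<le> p" and weak: "has_weak_deriv p A B g w"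
    and w: "w absolutely_integrable_on {A<..<B}" and g: "continuous_on {A..B} g"
    and h: "0 < h" and a: "A \<le> a" "a + real p * h \<le> B"
  shows "integral {a..a + real p * h} (\<lambda>t. \<bar>g t\<bar>)
      \<le> real p ^ (p + 1) * (h * (\<Sum>j<p. \<bar>g (a + real j * h)\<bar>))
        + (1 + real p ^ (p + 1)) * real p ^ p * (h ^ p * integral {a..a + real p * h} (\<lambda>t. \<bar>w t\<bar>))"
proof -
  define b where "b = a + real p * h"
  define E where "E = (\<Sum>j<p. \<bar>g (a + real j * h)\<bar>)"
  define I where "I = integral {a..b} (\<lambda>t. \<bar>w t\<bar>)"
  define X where "X = real p ^ p * E + (1 + real p * real p ^ p) * ((real p * h) ^ (p - 1) * I)"
  have "a \<le> b" using h by (simp add: b_def)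
  have "integral {a..b} (\<lambda>t. \<bar>g t\<bar>) \<le> integral {a..b} (\<lambda>t. X)"
  proof (rule integral_le)
    show "(\<lambda>t. \<bar>g t\<bar>) integrable_on {a..b}"
      using a by (intro integrable_continuous_real continuous_intros continuous_on_subset[OF g])
        (auto simp: b_def)
    show "\<bar>g t\<bar> \<le> X" if "t \<in> {a..b}" for t
      using window_pointwise_bound[OF p weak w g h a, of t] that
      by (simp add: X_def E_def I_def b_def)
  qed auto
  also have "\<dots> = real p * h * X" using \<open>a \<le> b\<close> by (simp add: b_def)
  also have "\<dots> = real p ^ (p + 1) * (h * E)
      + (1 + real p ^ (p + 1)) * ((real p * h) * (real p * h) ^ (p - 1)) * I"
    by (simp add: X_def algebra_simps)
  also have "(real p * h) * (real p * h) ^ (p - 1) = real p ^ p * h ^ p"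
    using p by (simp flip: power_mult_distrib add: power_eq_if[of _ p])
  finally show ?thesis by (simp add: b_def E_def I_def mult_ac)
qed

text \<open>Every index belongs to at most \<open>p\<close> windows of length \<open>p\<close>.\<close>

lemma sum_windows_le:
  fixes v :: "nat \<Rightarrow> real"
  assumes "\<And>n. 0 \<le> v n" "p \<le> N"
  shows "(\<Sum>k\<le>N - p. \<Sum>j<p. v (k + j)) \<le> real p * (\<Sum>n<N. v n)"
proof -
  have "(\<Sum>k\<le>N - p. v (k + j)) \<le> (\<Sum>n<N. v n)" if "j < p" for j
  proof -
    have "(\<Sum>k\<le>N - p. v (k + j)) = (\<Sum>n\<in>(\<lambda>k. k + j) ` {..N - p}. v n)"
      by (subst sum.reindex) (auto simp: inj_on_def)
    also have "\<dots> \<le> (\<Sum>n<N. v n)"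
      using that assms by (intro sum_mono2) auto
    finally show ?thesis .
  qed
  then have "(\<Sum>j<p. \<Sum>k\<le>N - p. v (k + j)) \<le> real (card {..<p}) * (\<Sum>n<N. v n)"
    by (intro sum_bounded_above) auto
  then show ?thesis by (subst sum.swap) simp
qed

lemma integral_grid_cells:
  fixes F :: "real \<Rightarrow> real"
  assumes int: "F integrable_on {a..a + real n * h}" and h: "0 < h"
  shows "(\<Sum>j<n. integral {a + real j * h..a + real (Suc j) * h} F) = integral {a..a + real n * h} F"
  using int
proof (induction n)
  case (Suc n)
  have le: "real n * h \<le> real (Suc n) * h" "0 \<le> real n * h"
    using h by (auto intro: mult_right_mono)
  have "F integrable_on {a..a + real n * h}"
    by (rule integrable_on_subinterval[OF Suc.prems]) (use le in auto)
  then show ?case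
    using Suc.IH le Henstock_Kurzweil_Integration.integral_combine[OF _ _ Suc.prems, of "a + real n * h"]
    by simp
qed simp

lemma integral_le_sum_windows:
  fixes F :: "real \<Rightarrow> real"
  assumes int: "F integrable_on {0..real N * h}" and F: "\<And>t. 0 \<le> F t"
    and h: "0 < h" and p: "1 \<le> p" "p \<le> N"
  shows "integral {0..real N * h} F \<le> (\<Sum>k\<le>N - p. integral {real k * h..real k * h + real p * h} F)"
proof -
  define cell where "cell n = integral {real n * h..real (Suc n) * h} F" for n
  have cell: "0 \<le> cell n" if "n < N" for n
    unfolding cell_def using that h
    by (intro integral_nonneg integrable_on_subinterval[OF int] F) (auto intro!: mult_right_mono simp del: of_nat_Suc)
  have window: "integral {real k * h..real k * h + real p * h} F = (\<Sum>j<p. cell (k + j))"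
    if "k \<le> N - p" for k
  proof -
    have "real (k + p) * h \<le> real N * h" using that p h by (intro mult_right_mono) auto
    then have "F integrable_on {real k * h..real k * h + real p * h}"
      using h by (intro integrable_on_subinterval[OF int]) (auto simp: algebra_simps)
    from integral_grid_cells[OF this h] show ?thesis
      by (simp add: cell_def algebra_simps)
  qed
  have "integral {0..real N * h} F = (\<Sum>n<N. cell n)"
    using integral_grid_cells[of F 0 N h] int h by (simp add: cell_def)
  also have "\<dots> \<le> (\<Sum>k\<le>N - p. \<Sum>j<p. cell (k + j))"
  proof -
    \<comment> \<open>The first window supplies the first \<open>p\<close> cells, every further window one more at its right end.\<close>
    have "(\<Sum>n<p + d. cell n) \<le> (\<Sum>k\<le>d. \<Sum>j<p. cell (k + j))" if "p + d \<le> N" for d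
      using that
    proof (induction d)
      case (Suc d)
      have "cell (p + d) \<le> (\<Sum>j<p. cell (Suc d + j))"
        using member_le_sum[of "p - 1" "{..<p}" "\<lambda>j. cell (Suc d + j)"] p Suc.prems cell
        by (auto simp: add.commute)
      then show ?case using Suc by simp
    qed simp
    from this[of "N - p"] show ?thesis using p by simp
  qed
  also have "\<dots> = (\<Sum>k\<le>N - p. integral {real k * h..real k * h + real p * h} F)"
    by (intro sum.cong) (auto simp: window)
  finally show ?thesis .
qed

text \<open>The windows \<open>[kh, (k+p)h]\<close> with \<open>k \<le> N - p\<close> cover \<open>[0, T]\<close>, and the \<open>p\<close> leftmost grid points of each of
  them have index less than \<open>N\<close>; the value \<open>g(T)\<close> does not appear, as the recurrence gives no
  information on it.\<close>

lemma integral_le_grid_sum: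
  fixes g w :: "real \<Rightarrow> real"
  assumes p: "1 \<le> p" "p \<le> N" and weak: "has_weak_deriv p 0 T g w"
    and w: "w absolutely_integrable_on {0<..<T}" and g: "continuous_on {0..T} g"
    and h: "0 < h" and T: "T = real N * h"
  shows "integral {0..T} (\<lambda>t. \<bar>g t\<bar>)
      \<le> real p ^ (p + 2) * (h * (\<Sum>n<N. \<bar>g (real n * h)\<bar>))
        + (1 + real p ^ (p + 1)) * real p ^ (p + 1) * (h ^ p * integral {0..T} (\<lambda>t. \<bar>w t\<bar>))"
proof -
  have gint: "(\<lambda>t. \<bar>g t\<bar>) integrable_on {0..T}"
    by (intro integrable_continuous_real continuous_intros g)
  have wint: "(\<lambda>t. \<bar>w t\<bar>) integrable_on {0..T}"
    using w by (simp add: absolutely_integrable_on_def integrable_on_Icc_iff_Ioo)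
  \<comment> \<open>Cells beyond the last one are given the value \<open>0\<close>, so that cells are nonnegative for all indices.\<close>
  define cell where "cell n = (if n < N then integral {real n * h..real (Suc n) * h} (\<lambda>t. \<bar>w t\<bar>) else 0)" for n
  have cell: "0 \<le> cell n" for n
  proof (cases "n < N")
    case True
    then have "real (Suc n) * h \<le> T" "0 \<le> real n * h"
      unfolding T using h by (auto intro!: mult_right_mono simp del: of_nat_Suc)
    then show ?thesis
      unfolding cell_def
      by (auto intro!: integral_nonneg integrable_on_subinterval[OF wint] simp del: of_nat_Suc)
  qed (simp add: cell_def)
  define W where "W k = integral {real k * h..real k * h + real p * h} (\<lambda>t. \<bar>w t\<bar>)" for k
  have le: "real k * h + real p * h \<le> T" if "k \<le> N - p" for k
  proof -
    have "real (k + p) * h \<le> real N * h" using that p h by (intro mult_right_mono) auto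
    then show ?thesis by (simp add: T algebra_simps)
  qed
  have W: "W k = (\<Sum>j<p. cell (k + j))" if k: "k \<le> N - p" for k
  proof -
    have "(\<lambda>t. \<bar>w t\<bar>) integrable_on {real k * h..real k * h + real p * h}"
      using h le[OF k] by (intro integrable_on_subinterval[OF wint]) auto
    from integral_grid_cells[OF this h]
    have "W k = (\<Sum>j<p. integral {real k * h + real j * h..real k * h + real (Suc j) * h} (\<lambda>t. \<bar>w t\<bar>))"
      by (simp add: W_def)
    also have "\<dots> = (\<Sum>j<p. cell (k + j))"
      using k p by (intro sum.cong) (auto simp: cell_def algebra_simps)
    finally show ?thesis .
  qed
  have sumW: "(\<Sum>k\<le>N - p. W k) \<le> real p * integral {0..T} (\<lambda>t. \<bar>w t\<bar>)"
  proof -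
    have "(\<Sum>k\<le>N - p. W k) = (\<Sum>k\<le>N - p. \<Sum>j<p. cell (k + j))"
      by (intro sum.cong) (auto simp: W)
    also have "\<dots> \<le> real p * (\<Sum>n<N. cell n)" by (rule sum_windows_le[OF cell p(2)])
    also have "(\<Sum>n<N. cell n) = integral {0..T} (\<lambda>t. \<bar>w t\<bar>)"
      using integral_grid_cells[of "\<lambda>t. \<bar>w t\<bar>" 0 N h] wint h by (simp add: cell_def T)
    finally show ?thesis .
  qed
  have sumE: "(\<Sum>k\<le>N - p. \<Sum>j<p. \<bar>g (real k * h + real j * h)\<bar>) \<le> real p * (\<Sum>n<N. \<bar>g (real n * h)\<bar>)"
    using sum_windows_le[of "\<lambda>n. \<bar>g (real n * h)\<bar>", OF _ p(2)] by (simp add: distrib_right)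
  have "integral {0..T} (\<lambda>t. \<bar>g t\<bar>)
      \<le> (\<Sum>k\<le>N - p. integral {real k * h..real k * h + real p * h} (\<lambda>t. \<bar>g t\<bar>))"
    unfolding T by (rule integral_le_sum_windows) (use gint T h p in auto)
  also have "\<dots> \<le> (\<Sum>k\<le>N - p. real p ^ (p + 1) * (h * (\<Sum>j<p. \<bar>g (real k * h + real j * h)\<bar>))
      + (1 + real p ^ (p + 1)) * real p ^ p * (h ^ p * W k))"
    unfolding W_def
    by (intro sum_mono window_integral_bound[OF p(1) weak w g h]) (use le h in auto)
  also have "\<dots> = real p ^ (p + 1) * (h * (\<Sum>k\<le>N - p. \<Sum>j<p. \<bar>g (real k * h + real j * h)\<bar>))
      + (1 + real p ^ (p + 1)) * real p ^ p * (h ^ p * (\<Sum>k\<le>N - p. W k))"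
    by (simp only: sum.distrib sum_distrib_left)
  also have "\<dots> \<le> real p ^ (p + 1) * (h * (real p * (\<Sum>n<N. \<bar>g (real n * h)\<bar>)))
      + (1 + real p ^ (p + 1)) * real p ^ p * (h ^ p * (real p * integral {0..T} (\<lambda>t. \<bar>w t\<bar>)))"
    using h by (intro add_mono mult_left_mono sumE sumW) auto
  also have "\<dots> = real p ^ (p + 2) * (h * (\<Sum>n<N. \<bar>g (real n * h)\<bar>))
        + (1 + real p ^ (p + 1)) * real p ^ (p + 1) * (h ^ p * integral {0..T} (\<lambda>t. \<bar>w t\<bar>))"
    by (simp add: mult_ac)
  finally show ?thesis .
qed

section \<open>Stability and error of the discovery scheme\<close>

lemma coeff_AB_discovery_poly:
  "coeff (AB_discovery_poly M) k = (if k < M then complex_of_real (AB_beta M (M - k)) else 0)"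
proof -
  have "coeff (AB_discovery_poly M) k
      = (\<Sum>m=1..M. if M - m = k then complex_of_real (AB_beta M m) else 0)"
    by (simp add: AB_discovery_poly_def coeff_sum)
  also have "\<dots> = (\<Sum>m=1..M. if m = M - k \<and> k < M then complex_of_real (AB_beta M m) else 0)"
    by (intro sum.cong) auto
  finally show ?thesis by (cases "k < M") auto
qed

lemma degree_AB_discovery_poly:
  assumes "1 \<le> M"
  shows "degree (AB_discovery_poly M) = M - 1"
proof (rule antisym)
  show "degree (AB_discovery_poly M) \<le> M - 1"
    by (rule degree_le) (auto simp: coeff_AB_discovery_poly)
  show "M - 1 \<le> degree (AB_discovery_poly M)"
    using AB_beta_1_pos[OF assms] assms by (intro le_degree) (simp add: coeff_AB_discovery_poly)
qed

lemma shift_op_AB_discovery_poly: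
  fixes e :: "nat \<Rightarrow> real"
  assumes "1 \<le> M"
  shows "shift_op (AB_discovery_poly M) (\<lambda>n. complex_of_real (e n)) n
      = complex_of_real (\<Sum>k<M. AB_beta M (Suc k) * e (n + M - Suc k))"
proof -
  have "{..degree (AB_discovery_poly M)} = {..<M}"
    using assms by (auto simp: degree_AB_discovery_poly)
  then have "shift_op (AB_discovery_poly M) (\<lambda>n. complex_of_real (e n)) n
      = complex_of_real (\<Sum>k<M. AB_beta M (M - k) * e (n + k))"
    unfolding shift_op_def by (simp add: coeff_AB_discovery_poly)
  also have "(\<Sum>k<M. AB_beta M (M - k) * e (n + k))
      = (\<Sum>k<M. AB_beta M (M - (M - Suc k)) * e (n + (M - Suc k)))"
    by (rule sum.nat_diff_reindex[symmetric])
  also have "\<dots> = (\<Sum>k<M. AB_beta M (Suc k) * e (n + M - Suc k))"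
    by (intro sum.cong) auto
  finally show ?thesis .
qed

text \<open>The window \<open>e\<^bsub>n-M\<^esub>, ..., e\<^bsub>n-1\<^esub>\<close> of the scheme is the window of the shift operator at
  position \<open>n - M\<close>, so \<open>N - M + 1\<close> equations determine \<open>e\<^sub>0, ..., e\<^bsub>N-1\<^esub>\<close> from the first \<open>M - 1\<close> values.\<close>

lemma AB_discovery_stable:
  assumes M: "2 \<le> M" and rho: "AB_rho M < 1"
  shows "\<exists>C>0. \<forall>N\<ge>M. \<forall>(e::nat \<Rightarrow> real) \<tau>.
      (\<forall>n\<in>{M..N}. \<bar>\<Sum>k<M. AB_beta M (Suc k) * e (n - Suc k)\<bar> \<le> \<tau>) \<longrightarrow>
      (\<Sum>n<N. \<bar>e n\<bar>) \<le> C * ((\<Sum>j=0..M - 2. \<bar>e j\<bar>) + real N * \<tau>)"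
proof -
  let ?q = "AB_discovery_poly M"
  have M1: "1 \<le> M" using M by simp
  have q0: "?q \<noteq> 0" using degree_AB_discovery_poly[OF M1] M by force
  have "finite {cmod z | z. poly ?q z = 0}"
    using poly_roots_finite[OF q0] by (simp add: setcompr_eq_image)
  then have "cmod z \<le> AB_rho M" if "poly ?q z = 0" for z
    unfolding AB_rho_def using that by (intro Max_ge) auto
  then have "cmod z < 1" if "poly ?q z = 0" for z
    using that rho by (meson le_less_trans)
  then obtain C where C: "C > 0" "\<And>K e. (\<Sum>n<K + degree ?q. cmod (e n))
      \<le> C * ((\<Sum>n<degree ?q. cmod (e n)) + (\<Sum>n<K. cmod (shift_op ?q e n)))"
    using stable_recurrence_sum_le[OF q0] by metis
  have "(\<Sum>n<N. \<bar>e n\<bar>) \<le> C * ((\<Sum>j=0..M - 2. \<bar>e j\<bar>) + real N * \<tau>)"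
    if N: "M \<le> N" and \<tau>: "\<And>n. n \<in> {M..N} \<Longrightarrow> \<bar>\<Sum>k<M. AB_beta M (Suc k) * e (n - Suc k)\<bar> \<le> \<tau>"
    for N e \<tau>
  proof -
    have "0 \<le> \<tau>" using \<tau>[of M] N by (meson abs_ge_zero atLeastAtMost_iff order.trans order_refl)
    define K where "K = N - M + 1"
    have KN: "K + degree ?q = N" using N M by (simp add: K_def degree_AB_discovery_poly)
    have "(\<Sum>n<K. cmod (shift_op ?q (\<lambda>n. complex_of_real (e n)) n)) \<le> real (card {..<K}) * \<tau>"
    proof (rule sum_bounded_above)
      fix n assume "n \<in> {..<K}"
      then have "n + M \<in> {M..N}" using N by (auto simp: K_def)
      from \<tau>[OF this] show "cmod (shift_op ?q (\<lambda>n. complex_of_real (e n)) n) \<le> \<tau>"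
        by (simp only: shift_op_AB_discovery_poly[OF M1] norm_of_real)
    qed
    also have "\<dots> \<le> real N * \<tau>"
      using \<open>0 \<le> \<tau>\<close> M N by (intro mult_right_mono) (auto simp: K_def)
    finally have 1: "(\<Sum>n<K. cmod (shift_op ?q (\<lambda>n. complex_of_real (e n)) n)) \<le> real N * \<tau>" .
    have init: "{..<degree ?q} = {0..M - 2}" using M by (auto simp: degree_AB_discovery_poly)
    have "(\<Sum>n<N. \<bar>e n\<bar>) \<le> C * ((\<Sum>j=0..M - 2. \<bar>e j\<bar>)
        + (\<Sum>n<K. cmod (shift_op ?q (\<lambda>n. complex_of_real (e n)) n)))"
      using C(2)[of "\<lambda>n. complex_of_real (e n)" K] unfolding KN init by simp
    also have "\<dots> \<le> C * ((\<Sum>j=0..M - 2. \<bar>e j\<bar>) + real N * \<tau>)"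
      using 1 C(1) by (intro mult_left_mono) auto
    finally show ?thesis .
  qed
  then show ?thesis using C(1) by (intro exI[of _ C]) blast
qed

text \<open>A vanishing sum of squares forces every residual to vanish; only \<open>\<alpha>\<^sub>0 = 1\<close> and \<open>\<alpha>\<^sub>1 = -1\<close> contribute to
  the difference quotient.\<close>

lemma zero_loss_grid_equation:
  assumes M: "1 \<le> M" and loss: "nonaux_loss M x i T N u = 0" and n: "n \<in> {M..N}"
  shows "(\<Sum>k<M. AB_beta M (Suc k) * u (grid_state x T N (n - Suc k)))
      = (grid_state x T N n $ i - grid_state x T N (n - 1) $ i) / step_size T N"
proof -
  have "(\<Sum>n=M..N. \<bar>(\<Sum>m=1..M. AB_beta M m * u (grid_state x T N (n - m)))
        - inverse (step_size T N) * (\<Sum>m=0..M. AB_alpha m * grid_state x T N (n - m) $ i)\<bar>\<^sup>2) = 0"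
    using loss unfolding nonaux_loss_def by simp
  then have eq: "(\<Sum>m=1..M. AB_beta M m * u (grid_state x T N (n - m)))
      = inverse (step_size T N) * (\<Sum>m=0..M. AB_alpha m * grid_state x T N (n - m) $ i)"
    using n by (subst (asm) sum_nonneg_eq_0_iff) auto
  have "(\<Sum>m=1..M. AB_beta M m * u (grid_state x T N (n - m)))
      = (\<Sum>k<M. AB_beta M (Suc k) * u (grid_state x T N (n - Suc k)))"
    by (rule sum.reindex_bij_witness[of _ Suc "\<lambda>m. m - 1"]) auto
  moreover have "(\<Sum>m=0..M. AB_alpha m * grid_state x T N (n - m) $ i)
      = (\<Sum>m\<in>{0, 1}. AB_alpha m * grid_state x T N (n - m) $ i)"
    using M by (intro sum.mono_neutral_right) (auto simp: AB_alpha_def)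
  ultimately show ?thesis using eq by (simp add: AB_alpha_def divide_inverse mult.commute)
qed

theorem theorem4p3:
  fixes x :: "real \<Rightarrow> real ^ 'd"
    and f :: "real ^ 'd \<Rightarrow> real ^ 'd"
    and x_init :: "real ^ 'd"
    and T :: real
    and \<Omega> :: "(real ^ 'd) set"
    and A :: "(real ^ 'd \<Rightarrow> real) set"
    and i :: 'd
    and M p :: nat
  assumes T_pos: "0 < T"
    and ode: "\<forall>t\<in>{0..T}. (x has_vector_derivative f (x t)) (at t within {0..T})"
    and init: "x 0 = x_init"
    and smooth: "C_k_on (p + 1) {0..T} x"
    and nbhd: "\<exists>U. open U \<and> x ` {0..T} \<subseteq> U \<and> U \<subseteq> \<Omega>"
    and admissible: "\<forall>u\<in>A. continuous_on \<Omega> u"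
    and M_ge_2: "2 \<le> M"
    and order: "p = M"
    and roots: "AB_rho M < 1"
  shows "\<exists>C_M>0. \<forall>R>0. \<forall>N\<ge>M. \<forall>u\<in>trace_class A x f i T p R.
           nonaux_loss M x i T N u = 0 \<longrightarrow>
           integral {0..T} (\<lambda>t. \<bar>u (x t) - f (x t) $ i\<bar>)
             \<le> C_M * (step_size T N *
                        (\<Sum>j=0..M - 2. \<bar>u (grid_state x T N j) - f (grid_state x T N j) $ i\<bar>)
                      + step_size T N ^ p + step_size T N ^ p * R)"
proof -
  have M1: "1 \<le> M" using M_ge_2 by simp
  obtain D where D0: "\<And>t. t \<in> {0..T} \<Longrightarrow> D 0 t = x t"
    and derD: "\<And>j t. j \<le> M \<Longrightarrow> t \<in> {0..T} \<Longrightarrow>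
        (D j has_vector_derivative D (Suc j) t) (at t within {0..T})"
    and contD: "\<And>j. j \<le> Suc M \<Longrightarrow> continuous_on {0..T} (D j)"
    using smooth unfolding C_k_on_def order by (metis Suc_eq_plus1 le_imp_less_Suc)
  define d where "d j t = D j t $ i" for j t
  have derd: "(d j has_real_derivative d (Suc j) t) (at t within {0..T})" if "j \<le> M" "t \<in> {0..T}" for j t
    using bounded_linear.has_vector_derivative[OF bounded_linear_vec_nth derD[OF that], of i]
    by (simp add: d_def[abs_def] has_real_derivative_iff_has_vector_derivative)
  have contd: "continuous_on {0..T} (d j)" if "j \<le> Suc M" for j
    unfolding d_def using contD[OF that] by (intro continuous_intros)
  have D1: "f (x t) $ i = d 1 t" if t: "t \<in> {0..T}" for t
  proof -
    have "(x has_vector_derivative D 1 t) (at t within {0..T})"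
      using derD[of 0 t] t by (intro has_vector_derivative_transform[OF t D0[symmetric]]) auto
    then have "f (x t) = D 1 t"
      using ode t T_pos vector_derivative_unique_within_closed_interval[of 0 T t x] by auto
    then show ?thesis by (simp add: d_def)
  qed
  obtain B where B: "0 \<le> B" "\<And>t. t \<in> {0..T} \<Longrightarrow> \<bar>d (Suc M) t\<bar> \<le> B"
  proof -
    have "bounded (d (Suc M) ` {0..T})"
      by (intro compact_imp_bounded compact_continuous_image contd) auto
    then obtain B where B: "\<forall>t\<in>{0..T}. \<bar>d (Suc M) t\<bar> \<le> B"
      unfolding bounded_iff by auto
    moreover from this have "0 \<le> B" using T_pos by force
    ultimately show ?thesis using that by blast
  qed
  define Ct where "Ct = B * (2 * real M ^ (M + 1) + real M ^ M * (\<Sum>k<M. \<bar>AB_beta M (Suc k)\<bar>))"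
  have Ct: "0 \<le> Ct"
    unfolding Ct_def using B(1) by (intro mult_nonneg_nonneg add_nonneg_nonneg sum_nonneg) auto
  obtain Cs where Cs: "Cs > 0" "\<And>N (e :: nat \<Rightarrow> real) \<tau>. M \<le> N \<Longrightarrow>
      (\<And>n. n \<in> {M..N} \<Longrightarrow> \<bar>\<Sum>k<M. AB_beta M (Suc k) * e (n - Suc k)\<bar> \<le> \<tau>) \<Longrightarrow>
      (\<Sum>n<N. \<bar>e n\<bar>) \<le> Cs * ((\<Sum>j=0..M - 2. \<bar>e j\<bar>) + real N * \<tau>)"
    using AB_discovery_stable[OF M_ge_2 roots] by blast
  define a1 where "a1 = real M ^ (M + 2)"
  define a2 where "a2 = (1 + real M ^ (M + 1)) * real M ^ (M + 1)"
  have a: "0 < a1" "0 \<le> a2" using M1 by (auto simp: a1_def a2_def)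
  \<comment> \<open>The three summands bound the coefficients of \<open>h E\<^sub>0\<close>, \<open>h\<^sup>M\<close> and \<open>h\<^sup>M R\<close> in the final estimate.\<close>
  define C where "C = a1 * Cs + a1 * Cs * Ct * T + a2"
  have C: "0 < C" "a1 * Cs \<le> C" "a1 * Cs * Ct * T \<le> C" "a2 \<le> C"
    using a Cs(1) Ct T_pos by (auto simp: C_def intro!: add_pos_nonneg)
  have "integral {0..T} (\<lambda>t. \<bar>u (x t) - f (x t) $ i\<bar>)
      \<le> C * (step_size T N * (\<Sum>j=0..M - 2. \<bar>u (grid_state x T N j) - f (grid_state x T N j) $ i\<bar>)
              + step_size T N ^ p + step_size T N ^ p * R)"
    if R: "R > 0" and N: "M \<le> N" and u: "u \<in> trace_class A x f i T p R"
      and loss: "nonaux_loss M x i T N u = 0" for R N u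
  proof -
    define h where "h = step_size T N"
    have h: "0 < h" and Nh: "real N * h = T" using N M1 T_pos by (auto simp: h_def step_size_def)
    define g where "g = trace_error x f i u"
    define w where "w = weak_deriv M 0 T g"
    have "\<exists>w. w absolutely_integrable_on {0<..<T} \<and> has_weak_deriv M 0 T g w"
      using u M1 by (auto simp: trace_class_def sobolev_W1_def g_def order)
    from someI_ex[OF this] have w: "w absolutely_integrable_on {0<..<T}" "has_weak_deriv M 0 T g w"
      unfolding w_def weak_deriv_def by auto
    have wR: "integral {0..T} (\<lambda>t. \<bar>w t\<bar>) \<le> R"
      using u by (simp add: trace_class_def sobolev_seminorm_def w_def g_def order integral_open_interval_real)
    have g_eq: "g t = u (x t) - d 1 t" if "t \<in> {0..T}" for t
      by (simp add: g_def trace_error_def D1[OF that])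
    have contg: "continuous_on {0..T} g"
    proof -
      have "continuous_on \<Omega> u" using u admissible by (auto simp: trace_class_def)
      moreover have "continuous_on {0..T} x"
        by (rule continuous_on_eq[of _ "D 0"]) (use contD[of 0] D0 in auto)
      ultimately have "continuous_on {0..T} (\<lambda>t. u (x t))"
        by (rule continuous_on_compose2) (use nbhd in blast)
      then have "continuous_on {0..T} (\<lambda>t. u (x t) - d 1 t)"
        by (intro continuous_on_diff contd) auto
      then show ?thesis by (rule continuous_on_eq) (simp add: g_eq)
    qed
    define e where "e n = g (real n * h)" for n
    have tn: "real n * h \<in> {0..T}" if "n \<le> N" for n
      unfolding Nh[symmetric] using that h by (auto intro: mult_right_mono)
    \<comment> \<open>The scheme holds exactly for \<open>u\<close> and up to the truncation error for \<open>d 1\<close>, the component of \<open>f\<close>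
      along the trajectory; the errors satisfy the difference of the two.\<close>
    have "\<bar>\<Sum>k<M. AB_beta M (Suc k) * e (n - Suc k)\<bar> \<le> Ct * h ^ M" if n: "n \<in> {M..N}" for n
    proof -
      define b where "b = real n * h"
      have node: "real (n - k) * h = b - real k * h" if "k \<le> M" for k
        using n that by (simp add: b_def of_nat_diff algebra_simps)
      have sub: "{b - real M * h..b} \<subseteq> {0..T}"
        using node[of M] tn[of "n - M"] tn[of n] n by (auto simp: b_def)
      have grid: "(\<Sum>k<M. AB_beta M (Suc k) * u (x (b - real (Suc k) * h))) = (d 0 b - d 0 (b - h)) / h"
      proof -
        have "(\<Sum>k<M. AB_beta M (Suc k) * u (x (b - real (Suc k) * h)))
            = (\<Sum>k<M. AB_beta M (Suc k) * u (grid_state x T N (n - Suc k)))"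
          by (intro sum.cong) (auto simp: grid_state_def node simp flip: h_def simp del: of_nat_Suc)
        also have "\<dots> = (grid_state x T N n $ i - grid_state x T N (n - 1) $ i) / h"
          unfolding h_def by (rule zero_loss_grid_equation[OF M1 loss n])
        also have "\<dots> = (d 0 b - d 0 (b - h)) / h"
        proof -
          have b1: "real (n - 1) * h = b - h" using node[of 1] M1 by simp
          have "b \<in> {0..T}" "b - h \<in> {0..T}"
            using tn[of n] tn[of "n - 1"] n b1 by (simp_all only: b_def) auto
          then have "d 0 b = x b $ i" "d 0 (b - h) = x (b - h) $ i" by (simp_all only: d_def D0)
          then show ?thesis by (simp only: grid_state_def b1 b_def flip: h_def)
        qed
        finally show ?thesis .
      qed
      have "(\<Sum>k<M. AB_beta M (Suc k) * e (n - Suc k))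
          = (\<Sum>k<M. AB_beta M (Suc k) * (u (x (b - real (Suc k) * h)) - d 1 (b - real (Suc k) * h)))"
      proof (intro sum.cong refl arg_cong2[where f = "(*)"])
        fix k assume "k \<in> {..<M}"
        then have nk: "real (n - Suc k) * h = b - real (Suc k) * h" by (intro node) auto
        have "real (n - Suc k) * h \<in> {0..T}" using n by (intro tn) auto
        then show "e (n - Suc k) = u (x (b - real (Suc k) * h)) - d 1 (b - real (Suc k) * h)"
          unfolding e_def nk by (rule g_eq)
      qed
      also have "\<dots> = - ((\<Sum>k<M. AB_beta M (Suc k) * d 1 (b - real (Suc k) * h)) - (d 0 b - d 0 (b - h)) / h)"
        unfolding right_diff_distrib sum_subtractf grid by simp
      also have "\<bar>\<dots>\<bar> \<le> Ct * h ^ M"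
        unfolding abs_minus_cancel Ct_def
        by (rule AB_truncation_error[OF M1, where a = "b - real M * h"])
           (use sub B h in \<open>auto intro: DERIV_subset[OF derd]\<close>)
      finally show ?thesis .
    qed
    then have sum_e: "(\<Sum>n<N. \<bar>e n\<bar>) \<le> Cs * ((\<Sum>j=0..M - 2. \<bar>e j\<bar>) + real N * (Ct * h ^ M))"
      by (intro Cs(2) N)
    define E0 where "E0 = (\<Sum>j=0..M - 2. \<bar>e j\<bar>)"
    have E0: "E0 = (\<Sum>j=0..M - 2. \<bar>u (grid_state x T N j) - f (grid_state x T N j) $ i\<bar>)"
      unfolding E0_def by (simp add: e_def g_def trace_error_def grid_state_def h_def)
    have "0 \<le> E0" by (simp add: E0_def sum_nonneg)
    have "integral {0..T} (\<lambda>t. \<bar>g t\<bar>)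
        \<le> a1 * (h * (\<Sum>n<N. \<bar>e n\<bar>)) + a2 * (h ^ M * integral {0..T} (\<lambda>t. \<bar>w t\<bar>))"
      unfolding a1_def a2_def e_def
      by (rule integral_le_grid_sum[OF M1 N w(2,1) contg h Nh[symmetric]])
    also have "\<dots> \<le> a1 * (h * (Cs * (E0 + real N * (Ct * h ^ M)))) + a2 * (h ^ M * R)"
      using a h sum_e wR by (intro add_mono mult_left_mono) (auto simp: E0_def)
    also have "\<dots> = a1 * Cs * (h * E0) + a1 * Cs * Ct * (real N * h) * h ^ M + a2 * (h ^ M * R)"
      by (simp add: algebra_simps)
    also have "\<dots> \<le> C * (h * E0) + C * h ^ M + C * (h ^ M * R)"
      unfolding Nh using C h R \<open>0 \<le> E0\<close> by (intro add_mono mult_right_mono) auto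
    also have "\<dots> = C * (h * E0 + h ^ p + h ^ p * R)"
      by (simp add: order algebra_simps)
    finally show ?thesis
      by (simp add: g_def trace_error_def E0 h_def)
  qed
  then show ?thesis using C(1) by blast
qed

end
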